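(* Assume that $\sigma$ satisfies: $\sigma(t,x,u)$ is symmetric and there are constants $L_\sigma,C_\sigma>0$ with $|\sigma(t,x,u)-\sigma(t,x',u')|\le L_\sigma(|x-x'|+|u-u'|)$ and $\frac1{C_\sigma}|z|^2\le|\sigma(t,x,u)z|^2\le C_\sigma|z|^2$ for all $t\in[0,T]$, $x,x'\in\mathbb R^d$, $u,u'\in\mathbb R^n$, $z\in\mathbb R^d$. Assume that there are constants $C_f>0$, $0<\epsilon<1$ such that for all $t\in[0,T]$, $x,x'\in\mathbb R^d$, $u,u'\in\mathbb R^n$, $p,p'\in(\mathbb R^d)^n$ and $i=1,\dots,n$: $$|f^i(t,x,u,p)|\le C_f\Big(1+|p^i||p|+\sum_{j<i}|p^j|^2+|p|^{2-\epsilon}\Big),$$ $$|f(t,x,u,p)-f(t,x',u',p)|\le C_f(1+|p|^2)(|x-x'|+|u-u'|),$$ $$|f(t,x,u,p)-f(t,x,u,p')|\le C_f(1+|p|+|p'|)|p-p'|.$$ Suppose further that, for each fixed $t$, $\sigma$ is continuously differentiable in $(x,u)$ and $f$ is continuously differentiable in $(x,u,p)$, and that $g\in C^1(\mathbb R^d)$ with bounded derivative. Let $u$ be a classical solution of $$\partial_t u^i+\mathrm{tr}(a(t,x,u)D^2u^i)+f^i(t,x,u,Du)=0\ \text{ in }(0,T)\times\mathbb R^d,\qquad u^i(T,x)=g^i(x),\qquad i=1,\dots,n,$$ with $a=\frac12\sigma\sigma^T$, such that $Du\in C^{1,2}([0,T]\times\mathbb R^d)$. Then for any $\alpha\in(0,1)$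 we have $$\|Du\|_{L^\infty}\le C,$$ where $C$ depends only on $\|Dg\|_{L^\infty},C_\sigma,L_\sigma,C_f,\alpha,\|u\|_{C^{0,\alpha}}$.
   Context: $n,d\in\mathbb N$ and $T\in(0,\infty)$ are fixed; constants may always depend on $n,d,T$. The data are functions $\sigma:[0,T]\times\mathbb R^d\times\mathbb R^n\to\mathbb R^{d\times d}$, $f=(f^i)_{i=1}^n:[0,T]\times\mathbb R^d\times\mathbb R^n\times(\mathbb R^d)^n\to\mathbb R^n$, $g=(g^i)_{i=1}^n:\mathbb R^d\to\mathbb R^n$. $|\cdot|$ is the Euclidean norm. $Du=(Du^i)_{i=1}^n\in(\mathbb R^d)^n$ is the spatial gradient. $v\in C^{1,2}(U)$ means that $\partial_tv,Dv,D^2v$ exist and are continuous on $U$. $\|v\|_{C^{0,\alpha}}=\|v\|_{L^\infty}+\sup_{t\ne t',x\ne x'}\frac{|v(t,x)-v(t',x')|}{|t-t'|^{\alpha/2}+|x-x'|^\alpha}$ for $v$ on $[0,T]\times\mathbb R^d$. Classical solution: $u\in C^{1,2}([0,T)\times\mathbb R^d;\mathbb R^n)\cap C([0,T]\times\mathbb R^d;\mathbb R^n)$ such that $u$ and $Du$ are bounded on $[0,T]\times\mathbb R^d$, the PDE holds pointwise in $[0,T)\times\mathbb R^d$, and $u(T,x)=g(x)$ for $x\in\mathbb R^d$. *)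

theory Defs
  imports "HOL-Analysis.Analysis"
begin

text \<open>
  Conventions: \<open>\<real>\<^sup>d\<close> is \<open>real^'d\<close>, \<open>\<real>\<^sup>n\<close> is \<open>real^'n\<close>, and \<open>(\<real>\<^sup>d)\<^sup>n\<close> is \<open>real^'d^'n\<close>, so that
  \<open>p $ i\<close> is the \<open>i\<close>-th gradient. The library norm on all these types, and on matrices, is the
  Euclidean (Frobenius) norm. The components carry the order \<open>1 < \<dots> < n\<close> through the linear order
  on \<open>'n\<close>.
\<close>

definition C1 :: "('a::real_normed_vector \<Rightarrow> 'b::real_normed_vector) \<Rightarrow> bool" where
  "C1 F \<longleftrightarrow> (\<exists>F' :: 'a \<Rightarrow> 'a \<Rightarrow>\<^sub>L 'b.
     (\<forall>x. (F has_derivative blinfun_apply (F' x)) (at x)) \<and> continuous_on UNIV F')"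

text \<open>
  \<open>C12 I v\<close> says \<open>v \<in> C\<^sup>1\<^sup>,\<^sup>2(I \<times> \<real>\<^sup>d)\<close>. The time derivative is taken within \<open>I\<close>, hence is one-sided
  at endpoints belonging to \<open>I\<close>.
\<close>
definition C12 :: "real set \<Rightarrow> (real \<Rightarrow> 'a::real_normed_vector \<Rightarrow> 'b::real_normed_vector) \<Rightarrow> bool" where
  "C12 I v \<longleftrightarrow> (\<exists>(vt :: real \<Rightarrow> 'a \<Rightarrow> 'b) (vx :: real \<Rightarrow> 'a \<Rightarrow> 'a \<Rightarrow>\<^sub>L 'b)
       (vxx :: real \<Rightarrow> 'a \<Rightarrow> 'a \<Rightarrow>\<^sub>L 'a \<Rightarrow>\<^sub>L 'b).
     (\<forall>t\<in>I. \<forall>x.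
        ((\<lambda>s. v s x) has_vector_derivative vt t x) (at t within I) \<and>
        (v t has_derivative blinfun_apply (vx t x)) (at x) \<and>
        (vx t has_derivative blinfun_apply (vxx t x)) (at x)) \<and>
     continuous_on (I \<times> UNIV) (\<lambda>(t, x). vt t x) \<and>
     continuous_on (I \<times> UNIV) (\<lambda>(t, x). vx t x) \<and>
     continuous_on (I \<times> UNIV) (\<lambda>(t, x). vxx t x))"

text \<open>\<open>Dx u t x $ i $ k\<close> is \<open>\<partial>\<^sub>k u\<^sup>i(t,x)\<close> and \<open>Dxx u i t x $ k $ l\<close> is \<open>\<partial>\<^sub>l \<partial>\<^sub>k u\<^sup>i(t,x)\<close>.\<close>
definition Dx :: "(real \<Rightarrow> real^'d \<Rightarrow> real^'n) \<Rightarrow> real \<Rightarrow> real^'d \<Rightarrow> real^'d^'n" where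
  "Dx u t x = jacobian (u t) (at x)"

definition Dxx :: "(real \<Rightarrow> real^'d \<Rightarrow> real^'n) \<Rightarrow> 'n \<Rightarrow> real \<Rightarrow> real^'d \<Rightarrow> real^'d^'d" where
  "Dxx u i t x = jacobian (\<lambda>y. Dx u t y $ i) (at x)"

text \<open>
  The \<open>L\<^sup>\<infinity>\<close> norm on \<open>S\<close>, used only for continuous functions on sets in which every point is a limit
  of interior points, where the essential supremum is the supremum. Norms take values in
  \<open>[0,\<infinity>]\<close>, so that unbounded suprema are not given a junk value.
\<close>
definition Linf_norm :: "'a set \<Rightarrow> ('a \<Rightarrow> 'b::real_normed_vector) \<Rightarrow> ereal" where
  "Linf_norm S v = (SUP z\<in>S. ereal (norm (v z)))"

definition holder_norm ::
  "real \<Rightarrow> real \<Rightarrow> (real \<Rightarrow> 'a::real_normed_vector \<Rightarrow> 'b::real_normed_vector) \<Rightarrow> ereal" where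
  "holder_norm T \<alpha> v =
     Linf_norm ({0..T} \<times> UNIV) (\<lambda>(t, x). v t x) +
     (SUP (t, x, t', x') \<in> {(t, x, t', x'). t \<in> {0..T} \<and> t' \<in> {0..T} \<and> t \<noteq> t' \<and> x \<noteq> x'}.
        ereal (norm (v t x - v t' x') / (\<bar>t - t'\<bar> powr (\<alpha> / 2) + norm (x - x') powr \<alpha>)))"

definition sigma_cond ::
  "real \<Rightarrow> real \<Rightarrow> real \<Rightarrow> (real \<Rightarrow> real^'d \<Rightarrow> real^'n \<Rightarrow> real^'d^'d) \<Rightarrow> bool" where
  "sigma_cond T L C \<sigma> \<longleftrightarrow> 0 < L \<and> 0 < C \<and>
     (\<forall>t\<in>{0..T}. \<forall>x u. transpose (\<sigma> t x u) = \<sigma> t x u) \<and>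
     (\<forall>t\<in>{0..T}. \<forall>x x' u u'.
        norm (\<sigma> t x u - \<sigma> t x' u') \<le> L * (norm (x - x') + norm (u - u'))) \<and>
     (\<forall>t\<in>{0..T}. \<forall>x u z.
        1 / C * (norm z)\<^sup>2 \<le> (norm (\<sigma> t x u *v z))\<^sup>2 \<and>
        (norm (\<sigma> t x u *v z))\<^sup>2 \<le> C * (norm z)\<^sup>2)"

definition f_cond ::
  "real \<Rightarrow> real \<Rightarrow> real \<Rightarrow>
   (real \<Rightarrow> real^'d \<Rightarrow> real^'n::{finite,linorder} \<Rightarrow> real^'d^'n::{finite,linorder} \<Rightarrow> real^'n::{finite,linorder}) \<Rightarrow> bool" where
  "f_cond T C \<epsilon> f \<longleftrightarrow> 0 < C \<and> 0 < \<epsilon> \<and> \<epsilon> < 1 \<and>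
     (\<forall>t\<in>{0..T}. \<forall>x u p i.
        \<bar>f t x u p $ i\<bar> \<le>
          C * (1 + norm (p $ i) * norm p + (\<Sum>j | j < i. (norm (p $ j))\<^sup>2)
                 + norm p powr (2 - \<epsilon>))) \<and>
     (\<forall>t\<in>{0..T}. \<forall>x x' u u' p.
        norm (f t x u p - f t x' u' p)
          \<le> C * (1 + (norm p)\<^sup>2) * (norm (x - x') + norm (u - u'))) \<and>
     (\<forall>t\<in>{0..T}. \<forall>x u p p'.
        norm (f t x u p - f t x u p') \<le> C * (1 + norm p + norm p') * norm (p - p'))"

definition classical_solution ::
  "real \<Rightarrow> (real \<Rightarrow> real^'d \<Rightarrow> real^'n \<Rightarrow> real^'d^'d) \<Rightarrow>
   (real \<Rightarrow> real^'d \<Rightarrow> real^'n \<Rightarrow> real^'d^'n \<Rightarrow> real^'n) \<Rightarrow> (real^'d \<Rightarrow> real^'n) \<Rightarrow>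
   (real \<Rightarrow> real^'d \<Rightarrow> real^'n) \<Rightarrow> bool" where
  "classical_solution T \<sigma> f g u \<longleftrightarrow>
     C12 {0..<T} u \<and>
     continuous_on ({0..T} \<times> UNIV) (\<lambda>(t, x). u t x) \<and>
     bounded ((\<lambda>(t, x). u t x) ` ({0..T} \<times> UNIV)) \<and>
     (\<forall>t\<in>{0..T}. \<forall>x. u t differentiable at x) \<and>
     bounded ((\<lambda>(t, x). Dx u t x) ` ({0..T} \<times> UNIV)) \<and>
     (\<forall>t\<in>{0..<T}. \<forall>x i.
        vector_derivative (\<lambda>s. u s x $ i) (at t within {0..<T})
        + trace (((1 / 2) *\<^sub>R (\<sigma> t x (u t x) ** transpose (\<sigma> t x (u t x)))) ** Dxx u i t x)
        + f t x (u t x) (Dx u t x) $ i = 0) \<and>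
     (\<forall>x. u T x = g x)"

end

theory Submission
  imports Defs
begin

text \<open>
  The gradient bound is proved by a localised Bernstein argument with an exponential weight, so that
  only the maximum principle is used. Write \<open>w = |Du|\<^sup>2\<close> and let \<open>Lh = h\<^sub>t + tr(a D\<^sup>2h)\<close> be the
  linear part of the equation along \<open>u\<close>.

  Differentiating the equation in \<open>x\<close> gives \<open>Lw \<ge> c|D\<^sup>2u|\<^sup>2 - C(1 + |Du|\<^sup>2)|D\<^sup>2u| - C(1 + |Du|\<^sup>4)\<close>.
  The good term absorbs the mixed one, and for \<open>w \<ge> 1\<close> there remains \<open>Lw \<ge> - c\<^sub>1 w\<^sup>2\<close>
  (\<open>gradient_energy_lower_bound\<close>). This quartic loss is what quadratic growth of \<open>f\<close> costs, and
  \<open>w\<close> alone cannot compensate it. The function \<open>v = |u - \<xi>|\<^sup>2\<close> with a constant vector \<open>\<xi>\<close> can: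
  \<open>Lv \<ge> c|Du|\<^sup>2 - C|u - \<xi>|(1 + |Du|\<^sup>2)\<close>, and where \<open>|u - \<xi>|\<close> is small this is at least a fixed
  multiple of \<open>w\<close> (\<open>oscillation_energy_lower_bound\<close>).

  Fix a point \<open>(t\<^sub>0,x\<^sub>0)\<close>, put \<open>\<xi> = u(t\<^sub>0,x\<^sub>0)\<close> and \<open>\<psi> = r\<^sup>2 - |x - x\<^sub>0|\<^sup>2 - (t - t\<^sub>0)\<close>, and maximise
  \<open>w exp(Kv) \<psi>\<^sup>2\<close> over the compact set where \<open>t\<^sub>0 \<le> t \<le> T\<close> and \<open>\<psi> \<ge> 0\<close>. At a maximum before the
  terminal time the logarithm \<open>ln w + Kv + 2 ln \<psi>\<close> has vanishing gradient, so the squared gradient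
  \<open>|D ln w|\<^sup>2\<close> is controlled by \<open>K\<^sup>2|Dv|\<^sup>2 \<le> C K\<^sup>2 |u - \<xi>|\<^sup>2 w\<close> and by \<open>|D\<psi>|\<^sup>2/\<psi>\<^sup>2\<close>. Applying \<open>L\<close> to the
  logarithm yields \<open>0 \<ge> (cK - c\<^sub>1 - C K\<^sup>2 |u - \<xi>|\<^sup>2) w - C r\<^sup>2/\<psi>\<^sup>2\<close>: with \<open>K\<close> large first and the oscillation
  of \<open>u\<close> small afterwards, \<open>w\<psi>\<^sup>2 \<le> C r\<^sup>2\<close> (\<open>interior_maximum_bound\<close>). At a maximum at time \<open>T\<close> the
  gradient is \<open>Dg\<close>. Either way \<open>|Du(t\<^sub>0,x\<^sub>0)|\<close> is bounded in terms of \<open>r\<close>, \<open>K\<close> and \<open>\<parallel>Dg\<parallel>\<close>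
  (\<open>local_gradient_bound\<close>). The Hoelder norm of \<open>u\<close> tells how small \<open>r\<close> must be for the oscillation
  of \<open>u\<close> on the cylinder to be small.

  Two points need care. The Hoelder norm takes values in \<open>[0,\<infinity>]\<close>, and if it could be infinite, one
  constant would have to serve all such solutions; but a bounded solution with bounded gradient is
  \<open>1/2\<close>-Hoelder in time by comparison with a quadratic barrier, so the norm is always finite
  (\<open>holder_norm_finite\<close>). And the differentiated equation needs \<open>\<partial>\<^sub>t Du = D \<partial>\<^sub>t u\<close>, which is obtained by
  differentiating \<open>u(t,x + he) - u(t,x) = \<integral> Du(t,x + re)e dr\<close> under the integral
  (\<open>mixed_derivative\<close>). The derivatives of \<open>\<sigma>\<close> and \<open>f\<close> along \<open>u\<close> are bounded through difference
  quotients in \<open>x\<close>, that is, by the given Lipschitz constants (\<open>norm_derivative_le\<close>).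
\<close>

section \<open>Matrices and sums over directions\<close>

lemma norm_matrix_vector_mult_le:
  fixes M :: "real^'d^'m"
  shows "norm (M *v x) \<le> norm M * norm x"
proof -
  have "norm (M *v x) = L2_set (\<lambda>i. \<bar>M $ i \<bullet> x\<bar>) UNIV"
    by (simp add: norm_vec_def matrix_vector_mul_component L2_set_def)
  also have "\<dots> \<le> L2_set (\<lambda>i. norm x * norm (M $ i)) UNIV"
    by (intro L2_set_mono) (use Cauchy_Schwarz_ineq2[of "M $ i" x for i] in \<open>auto simp: mult.commute\<close>)
  also have "\<dots> = norm x * L2_set (\<lambda>i. norm (M $ i)) UNIV"
    by (simp add: L2_set_right_distrib)
  finally show ?thesis
    by (simp add: norm_vec_def mult.commute)
qed

lemma norm_squared_vec_eq_sum: "(norm (y :: 'a::real_normed_vector^'k))\<^sup>2 = (\<Sum>i\<in>UNIV. (norm (y $ i))\<^sup>2)"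
  unfolding norm_vec_def L2_set_def by (intro real_sqrt_pow2 sum_nonneg) simp

lemma norm_squared_eq_sum_columns:
  fixes M :: "real^'d^'m"
  shows "(norm M)\<^sup>2 = (\<Sum>k\<in>UNIV. (norm (M *v axis k 1))\<^sup>2)"
proof -
  have "(norm M)\<^sup>2 = (\<Sum>i\<in>UNIV. \<Sum>k\<in>UNIV. (M $ i $ k)\<^sup>2)"
    by (simp add: norm_squared_vec_eq_sum)
  also have "\<dots> = (\<Sum>k\<in>UNIV. \<Sum>i\<in>UNIV. (M $ i $ k)\<^sup>2)"
    by (rule sum.swap)
  also have "\<dots> = (\<Sum>k\<in>UNIV. (norm (M *v axis k 1))\<^sup>2)"
    by (simp add: norm_squared_vec_eq_sum matrix_vector_mult_basis column_def)
  finally show ?thesis .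
qed

lemma norm_le_sum_columns:
  fixes M :: "real^'d^'m"
  shows "norm M \<le> (\<Sum>k\<in>UNIV. norm (M *v axis k 1))"
proof -
  have "norm M = L2_set (\<lambda>k. norm (M *v axis k 1)) UNIV"
    unfolding L2_set_def norm_squared_eq_sum_columns[symmetric] by simp
  then show ?thesis
    by (simp add: L2_set_le_sum)
qed

lemma norm_squared_eq_sum_axis: "(norm (z :: real^'d))\<^sup>2 = (\<Sum>k\<in>UNIV. (axis k 1 \<bullet> z)\<^sup>2)"
  by (simp add: norm_squared_vec_eq_sum inner_axis')

lemma norm_linear_le_sum_axis:
  fixes B :: "real^'d \<Rightarrow> 'v::euclidean_space"
  assumes "linear B"
  shows "norm (B z) \<le> sqrt (\<Sum>k\<in>UNIV. (norm (B (axis k 1)))\<^sup>2) * norm z"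
proof -
  have "B z = B (\<Sum>k\<in>UNIV. (z $ k) *\<^sub>R axis k 1)"
    by (simp only: scalar_mult_eq_scaleR[symmetric] basis_expansion)
  also have "\<dots> = (\<Sum>k\<in>UNIV. (z $ k) *\<^sub>R B (axis k 1))"
    using assms by (simp add: linear_sum linear_cmul)
  finally have "norm (B z) \<le> (\<Sum>k\<in>UNIV. \<bar>z $ k\<bar> * norm (B (axis k 1)))"
    by (simp add: sum_norm_le)
  also have "\<dots> \<le> L2_set (\<lambda>k. z $ k) UNIV * L2_set (\<lambda>k. norm (B (axis k 1))) UNIV"
    using L2_set_mult_ineq[of "\<lambda>k. z $ k" "\<lambda>k. norm (B (axis k 1))" UNIV] by simp
  also have "L2_set (\<lambda>k. z $ k) UNIV = norm z"
    by (simp add: norm_vec_def L2_set_def)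
  finally show ?thesis
    unfolding L2_set_def by (simp only: mult.commute)
qed

text \<open>
  For each coordinate functional \<open>b\<close> of the target, \<open>B(\<sigma>e\<^sub>m) \<bullet> b = e\<^sub>m \<bullet> \<sigma>(B\<^sup>*b)\<close> by symmetry of \<open>\<sigma>\<close>;
  summing squares over \<open>m\<close> gives \<open>|\<sigma>(B\<^sup>*b)|\<^sup>2\<close>, to which ellipticity applies. It is used for \<open>B = Du\<close>
  and for \<open>B = D\<^sup>2u\<close>.
\<close>
lemma elliptic_sum_lower_bound:
  fixes B :: "real^'d \<Rightarrow> 'v::euclidean_space" and S :: "real^'d^'d"
  assumes "linear B" "transpose S = S" "\<And>z. c * (norm z)\<^sup>2 \<le> (norm (S *v z))\<^sup>2"
  shows "c * (\<Sum>k\<in>UNIV. (norm (B (axis k 1)))\<^sup>2) \<le> (\<Sum>m\<in>UNIV. (norm (B (S *v axis m 1)))\<^sup>2)"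
proof -
  have nrm: "(norm (B z))\<^sup>2 = (\<Sum>b\<in>Basis. (z \<bullet> adjoint B b)\<^sup>2)" for z
    using assms(1) unfolding power2_norm_eq_inner euclidean_inner[of "B z" "B z"] by (simp add: adjoint_works power2_eq_square)
  have sw: "(S *v y) \<bullet> z = y \<bullet> (S *v z)" for y z
    by (metis assms(2) dot_lmul_matrix inner_commute transpose_matrix_vector)
  have "c * (\<Sum>k\<in>UNIV. (norm (B (axis k 1)))\<^sup>2) = (\<Sum>b\<in>Basis. c * (norm (adjoint B b))\<^sup>2)"
    unfolding nrm norm_squared_eq_sum_axis sum_distrib_left by (rule sum.swap)
  also have "\<dots> \<le> (\<Sum>b\<in>Basis. (norm (S *v adjoint B b))\<^sup>2)"
    by (intro sum_mono assms)
  also have "\<dots> = (\<Sum>m\<in>UNIV. (norm (B (S *v axis m 1)))\<^sup>2)"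
    unfolding nrm norm_squared_eq_sum_axis sw by (rule sum.swap)
  finally show ?thesis .
qed

lemma bounded_bilinear_matrix_vector:
  "bounded_bilinear (\<lambda>(M :: real^'d^'m) x. M *v x)"
proof
  show "\<exists>K. \<forall>a b. norm ((a :: real^'d^'m) *v b) \<le> norm a * norm b * K"
    by (intro exI[of _ 1]) (simp add: norm_matrix_vector_mult_le)
qed (simp_all add: matrix_vector_mult_add_rdistrib matrix_vector_right_distrib
    scaleR_matrix_vector_assoc[symmetric] matrix_vector_mult_scaleR)

section \<open>Derivatives along lines, mixed derivatives and difference quotients\<close>

lemma has_real_derivative_inner:
  assumes "(g has_vector_derivative g') (at s within X)" "(h has_vector_derivative h') (at s within X)"
  shows "((\<lambda>s. g s \<bullet> h s) has_real_derivative g s \<bullet> h' + g' \<bullet> h s) (at s within X)"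
  using bounded_bilinear.has_vector_derivative[OF bounded_bilinear_inner assms]
  by (simp add: has_real_derivative_iff_has_vector_derivative)

lemma has_real_derivative_norm_squared:
  fixes g :: "real \<Rightarrow> 'b::real_inner"
  assumes "(g has_vector_derivative g') (at s within X)"
  shows "((\<lambda>s. (norm (g s))\<^sup>2) has_real_derivative 2 * (g s \<bullet> g')) (at s within X)"
  using has_real_derivative_inner[OF assms assms] by (simp add: power2_norm_eq_inner inner_commute)

lemma has_vector_derivative_along_line:
  assumes "(g has_derivative g') (at (x + s *\<^sub>R e))"
  shows "((\<lambda>s. g (x + s *\<^sub>R e)) has_vector_derivative g' e) (at s within U)"
proof -
  have "((\<lambda>s. x + s *\<^sub>R e) has_vector_derivative e) (at s within U)"
    by (auto intro!: derivative_eq_intros)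
  then have "(g \<circ> (\<lambda>s. x + s *\<^sub>R e) has_vector_derivative g' e) (at s within U)"
    using assms has_derivative_at_withinI vector_derivative_diff_chain_within by blast
  then show ?thesis by (simp add: o_def)
qed

text \<open>
  The increment \<open>\<phi> s h - \<phi> s 0\<close> is the integral of \<open>a s\<close> over \<open>{0..h}\<close>. Differentiating it in \<open>s\<close> under
  the integral gives \<open>c h - c 0\<close> as the integral of \<open>b s0\<close>, and the fundamental theorem of calculus
  gives the derivative at \<open>h = 0\<close>. With \<open>s\<close> as time this
  exchanges \<open>\<partial>\<^sub>t\<close> and \<open>D\<close>; with \<open>s\<close> as a second space variable it is the symmetry of second derivatives.
\<close>
lemma mixed_derivative:
  fixes \<phi> :: "real \<Rightarrow> real \<Rightarrow> 'b::euclidean_space"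
  assumes I: "convex I" "s0 \<in> I" "at s0 within I \<noteq> bot"
    and a: "\<And>s h. s \<in> I \<Longrightarrow> h \<in> {0..1} \<Longrightarrow> (\<phi> s has_vector_derivative a s h) (at h within {0..1})"
    and b: "\<And>s h. s \<in> I \<Longrightarrow> h \<in> {0..1} \<Longrightarrow> ((\<lambda>s. a s h) has_vector_derivative b s h) (at s within I)"
    and cont: "continuous_on (I \<times> {0..1}) (\<lambda>(s, h). b s h)"
    and c: "\<And>h. h \<in> {0..1} \<Longrightarrow> ((\<lambda>s. \<phi> s h) has_vector_derivative c h) (at s0 within I)"
  shows "(c has_vector_derivative b s0 0) (at 0 within {0..1})"
proof -
  have ftc: "(a s has_integral \<phi> s h - \<phi> s 0) {0..h}" if "s \<in> I" "h \<in> {0..1}" for s h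
    using that a
    by (intro fundamental_theorem_of_calculus)
       (auto intro: has_vector_derivative_within_subset[of _ _ _ "{0..1}"])
  have c_eq: "c h = c 0 + integral {0..h} (b s0)" if h: "h \<in> {0..1}" for h
  proof -
    have "((\<lambda>s. integral (cbox 0 h) (a s)) has_vector_derivative integral (cbox 0 h) (b s0))
        (at s0 within I)"
    proof (rule leibniz_rule_vector_derivative)
      show "((\<lambda>s. a s r) has_vector_derivative b s r) (at s within I)"
        if "s \<in> I" "r \<in> cbox 0 h" for s r using b that h by auto
      show "a s integrable_on cbox 0 h" if "s \<in> I" for s
        using ftc[OF that h] by auto
      show "continuous_on (I \<times> cbox 0 h) (\<lambda>(s, r). b s r)"
        by (rule continuous_on_subset[OF cont]) (use h in auto)
    qed (use I in auto)
    then have 1: "((\<lambda>s. \<phi> s h - \<phi> s 0) has_vector_derivative integral {0..h} (b s0)) (at s0 within I)"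
      unfolding cbox_interval
      by (rule has_vector_derivative_transform[OF I(2), rotated])
         (simp add: integral_unique[OF ftc[OF _ h]])
    have 2: "((\<lambda>s. \<phi> s h - \<phi> s 0) has_vector_derivative c h - c 0) (at s0 within I)"
      using c[OF h] c[of 0] by (auto intro!: derivative_eq_intros)
    show ?thesis
      using vector_derivative_unique_within[OF I(3) 1 2] by simp
  qed
  have "continuous_on {0..1} (b s0)"
    using continuous_on_compose2[OF cont, of "{0..1}" "\<lambda>h. (s0, h)"] I(2)
    by (fastforce intro!: continuous_intros)
  then have "((\<lambda>h. integral {0..h} (b s0)) has_vector_derivative b s0 0) (at 0 within {0..1})"
    by (intro integral_has_vector_derivative) auto
  then have "((\<lambda>h. c 0 + integral {0..h} (b s0)) has_vector_derivative b s0 0) (at 0 within {0..1})"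
    by (auto intro!: derivative_eq_intros)
  then show ?thesis
    by (rule has_vector_derivative_transform[rotated 2]) (auto simp: c_eq[symmetric])
qed

lemma at_within_Ico_neq_bot:
  fixes T :: real
  assumes "t \<in> {0..<T}" shows "at t within {0..<T} \<noteq> bot"
proof -
  have "0 \<in> {0..<T}" "T / 2 \<in> {0..<T}" "T / 2 \<noteq> 0"
    using assms by auto
  then have "{0..<T} \<noteq> {t}" by (metis singletonD)
  then show ?thesis
    using connected_imp_perfect[of "{0..<T}" t] assms by (simp add: trivial_limit_within)
qed

lemma second_derivative_symmetric:
  fixes G :: "'a::euclidean_space \<Rightarrow> 'b::euclidean_space" and D :: "'a \<Rightarrow> 'a \<Rightarrow> 'b"
  assumes D: "\<And>x. (G has_derivative D x) (at x)"
    and DD: "\<And>x z. ((\<lambda>x. D x z) has_derivative (\<lambda>y. DD x y z)) (at x)"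
    and cont: "\<And>y z. continuous_on UNIV (\<lambda>x. DD x y z)"
  shows "DD x e e' = DD x e' e"
proof -
  have 1: "((\<lambda>h. D (x + h *\<^sub>R e') e) has_vector_derivative DD (x + 0 *\<^sub>R e + 0 *\<^sub>R e') e e') (at 0 within {0..1})"
  proof (rule mixed_derivative[where I = UNIV
        and \<phi> = "\<lambda>s h. G (x + s *\<^sub>R e + h *\<^sub>R e')" and a = "\<lambda>s h. D (x + s *\<^sub>R e + h *\<^sub>R e') e'"
        and b = "\<lambda>s h. DD (x + s *\<^sub>R e + h *\<^sub>R e') e e'"])
    show "((\<lambda>h. G (x + s *\<^sub>R e + h *\<^sub>R e')) has_vector_derivative D (x + s *\<^sub>R e + h *\<^sub>R e') e')
        (at h within {0..1})" for s h
      by (rule has_vector_derivative_along_line[OF D])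
    show "((\<lambda>s. D (x + s *\<^sub>R e + h *\<^sub>R e') e') has_vector_derivative
        DD (x + s *\<^sub>R e + h *\<^sub>R e') e e') (at s within UNIV)" for s h
      using has_vector_derivative_along_line[where x = "x + h *\<^sub>R e'" and s = s and e = e and U = UNIV, OF DD[where z = e']]
      by (simp add: algebra_simps)
    show "((\<lambda>s. G (x + s *\<^sub>R e + h *\<^sub>R e')) has_vector_derivative D (x + h *\<^sub>R e') e) (at 0)" for h
      using has_vector_derivative_along_line[where x = "x + h *\<^sub>R e'" and s = 0 and e = e and U = UNIV, OF D]
      by (simp add: algebra_simps)
    show "continuous_on (UNIV \<times> {0..1}) (\<lambda>(s, h). DD (x + s *\<^sub>R e + h *\<^sub>R e') e e')"
      unfolding case_prod_unfold
      by (intro continuous_intros continuous_on_compose2[OF cont]) auto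
  qed auto
  have 2: "((\<lambda>h. D (x + h *\<^sub>R e') e) has_vector_derivative DD x e' e) (at 0 within {0..1})"
    using has_vector_derivative_along_line[where x = x and s = 0 and e = e' and U = "{0..1}", OF DD[where z = e]] by simp
  have "at (0::real) within {0..1} \<noteq> bot"
    by (simp add: at_within_Icc_at_right trivial_limit_at_right_real)
  from vector_derivative_unique_within[OF this 1 2] show ?thesis by simp
qed

lemma difference_quotient_tendsto:
  assumes "(g has_derivative g') (at x)"
  shows "((\<lambda>h. (g (x + h *\<^sub>R e) - g x) /\<^sub>R h) \<longlongrightarrow> g' e) (at_right 0)"
proof -
  have "((\<lambda>h. g (x + h *\<^sub>R e)) has_vector_derivative g' e) (at 0)"
    using has_vector_derivative_along_line[where x = x and s = 0 and e = e and U = UNIV] assms by simp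
  then have "((\<lambda>h. (g (x + h *\<^sub>R e) - g x - h *\<^sub>R g' e) /\<^sub>R norm h) \<longlongrightarrow> 0) (at_right 0)"
    unfolding has_vector_derivative_def has_derivative_at2
    by (auto simp: diff_diff_eq inverse_eq_divide intro: tendsto_mono[OF at_le])
  then have "((\<lambda>h. (g (x + h *\<^sub>R e) - g x) /\<^sub>R h - g' e) \<longlongrightarrow> 0) (at_right 0)"
    by (rule Lim_transform_eventually)
       (auto simp: eventually_at_filter scaleR_diff_right)
  then show ?thesis by (simp add: LIM_zero_iff)
qed

text \<open>
  Bounds a directional derivative of a composite such as \<open>x \<mapsto> \<sigma>(t,x,u(t,x))\<close> directly by the
  Lipschitz condition on the outer function, whose own derivatives then never have to be named.
\<close>
lemma norm_derivative_le:
  assumes "(g has_derivative g') (at x)"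
    and "\<And>h. 0 < h \<Longrightarrow> norm (g (x + h *\<^sub>R e) - g x) \<le> h * k h"
    and "(k \<longlongrightarrow> k0) (at_right 0)"
  shows "norm (g' e) \<le> k0"
proof (rule tendsto_le[OF _ assms(3) tendsto_norm[OF difference_quotient_tendsto[OF assms(1), of e]]])
  show "eventually (\<lambda>h. norm ((g (x + h *\<^sub>R e) - g x) /\<^sub>R h) \<le> k h) (at_right 0)"
  proof (rule eventually_mono[OF eventually_at_right_less])
    fix h :: real assume h: "0 < h"
    have "norm ((g (x + h *\<^sub>R e) - g x) /\<^sub>R h) = norm (g (x + h *\<^sub>R e) - g x) / h"
      using h by (simp add: divide_inverse)
    then show "norm ((g (x + h *\<^sub>R e) - g x) /\<^sub>R h) \<le> k h"
      using assms(2)[OF h] h by (simp add: divide_le_eq mult.commute)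
  qed
qed simp

section \<open>Derivative tests at a maximum\<close>

lemma derivative_tests_at_local_max:
  fixes h :: "real \<Rightarrow> real"
  assumes d: "0 < d"
    and h1: "\<And>s. \<bar>s\<bar> < d \<Longrightarrow> (h has_real_derivative h1 s) (at s)"
    and h2: "(h1 has_real_derivative l) (at 0)"
    and max: "\<And>s. \<bar>s\<bar> < d \<Longrightarrow> h s \<le> h 0"
  shows "h1 0 = 0" and "l \<le> 0"
proof -
  show z: "h1 0 = 0"
    using DERIV_local_max[OF h1[of 0] d] d max by auto
  show "l \<le> 0"
  proof (rule ccontr)
    assume "\<not> l \<le> 0"
    then obtain d' where d': "d' > 0" "\<And>y. y > 0 \<Longrightarrow> y < d' \<Longrightarrow> h1 0 < h1 y"
      using DERIV_pos_inc_right[OF h2] by auto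
    define y where "y = min d d' / 2"
    have y: "0 < y" "y < d" "y < d'"
      using d d' by (auto simp: y_def)
    have "h 0 < h y"
    proof (rule DERIV_pos_imp_increasing_open[OF y(1)])
      show "\<exists>l. (h has_real_derivative l) (at s) \<and> 0 < l" if "0 < s" "s < y" for s
        using h1[of s] d'(2)[of s] that y z by auto
      show "continuous_on {0..y} h"
        using y by (intro continuous_at_imp_continuous_on ballI DERIV_isCont[OF h1]) auto
    qed
    with max[of y] y show False by auto
  qed
qed

lemma right_derivative_nonpos_at_max:
  fixes h :: "real \<Rightarrow> real"
  assumes "(h has_real_derivative l) (at t within {0..<T})" "0 \<le> t" "t < T" "0 < d"
    and max: "\<And>s. t \<le> s \<Longrightarrow> s < T \<Longrightarrow> s < t + d \<Longrightarrow> h s \<le> h t"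
  shows "l \<le> 0"
proof (rule ccontr)
  assume "\<not> l \<le> 0"
  then obtain d' where d': "d' > 0" "\<And>y. y > 0 \<Longrightarrow> t + y \<in> {0..<T} \<Longrightarrow> y < d' \<Longrightarrow> h t < h (t + y)"
    using has_real_derivative_pos_inc_right[OF assms(1)] by auto
  define y where "y = min (min d d') (T - t) / 2"
  have "0 < y" "y < d" "y < d'" "y < T - t"
    using assms d' by (auto simp: y_def)
  moreover from this have "h t < h (t + y)" "h (t + y) \<le> h t"
    using d'(2)[of y] max[of "t + y"] assms(2,3) by auto
  ultimately show False by simp
qed

text \<open>
  The second-order condition at a maximum of \<open>h = ln W + K V + 2 ln Z\<close>. The logarithm produces the
  unwanted term \<open>-(W'/W)\<^sup>2\<close>, but \<open>h' = 0\<close> says \<open>W'/W = -(K V' + 2 Z'/Z)\<close>, so that this term is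
  bounded by \<open>2 K\<^sup>2 V'\<^sup>2 + 8 (Z'/Z)\<^sup>2\<close>; two further copies of \<open>(Z'/Z)\<^sup>2\<close> come from \<open>2 ln Z\<close>.
\<close>
lemma log_product_second_derivative_test:
  fixes W V Z :: "real \<Rightarrow> real"
  assumes W: "\<And>s. (W has_real_derivative W1 s) (at s)" "(W1 has_real_derivative W2) (at 0)"
    and V: "\<And>s. (V has_real_derivative V1 s) (at s)" "(V1 has_real_derivative V2) (at 0)"
    and Z: "\<And>s. (Z has_real_derivative Z1 s) (at s)" "(Z1 has_real_derivative Z2) (at 0)"
    and pos: "0 < W 0" "0 < Z 0" and d: "0 < d"
    and max: "\<And>s. \<bar>s\<bar> < d \<Longrightarrow> W s * exp (K * V s) * (Z s)\<^sup>2 \<le> W 0 * exp (K * V 0) * (Z 0)\<^sup>2"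
  shows "W2 / W 0 + K * V2 + 2 * (Z2 / Z 0) \<le> 2 * K\<^sup>2 * (V1 0)\<^sup>2 + 10 * (Z1 0 / Z 0)\<^sup>2"
proof -
  have "isCont W 0" "isCont Z 0"
    using W(1) Z(1) DERIV_isCont by blast+
  then have "eventually (\<lambda>s. 0 < W s \<and> 0 < Z s) (nhds 0)"
    unfolding isCont_def using pos
    by (intro eventually_conj) (auto simp: tendsto_at_iff_tendsto_nhds dest: order_tendstoD(1)) 
  then obtain d1 where d1: "d1 > 0" "\<And>s. \<bar>s\<bar> < d1 \<Longrightarrow> 0 < W s \<and> 0 < Z s"
    by (auto simp: eventually_nhds_metric dist_real_def)
  let ?h = "\<lambda>s. ln (W s) + K * V s + 2 * ln (Z s)"
  let ?h1 = "\<lambda>s. W1 s / W s + K * V1 s + 2 * (Z1 s / Z s)"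
  have 1: "(?h has_real_derivative ?h1 s) (at s)" if "\<bar>s\<bar> < min d d1" for s
  proof -
    have "0 < W s" "0 < Z s" using d1(2)[of s] that by auto
    from DERIV_add[OF DERIV_add[OF DERIV_chain2[OF DERIV_ln_divide[OF this(1)] W(1)] DERIV_cmult[OF V(1)]]
        DERIV_cmult[OF DERIV_chain2[OF DERIV_ln_divide[OF this(2)] Z(1)]]]
    show ?thesis by simp
  qed
  have 2: "(?h1 has_real_derivative
      (W2 * W 0 - W1 0 * W1 0) / (W 0 * W 0) + K * V2 + 2 * ((Z2 * Z 0 - Z1 0 * Z1 0) / (Z 0 * Z 0))) (at 0)"
    using pos by (intro DERIV_add DERIV_cmult DERIV_divide W V Z) auto
  have 3: "?h s \<le> ?h 0" if "\<bar>s\<bar> < min d d1" for s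
  proof -
    have p: "0 < W s" "0 < Z s" using d1(2)[of s] that by auto
    have "ln (W s * exp (K * V s) * (Z s)\<^sup>2) \<le> ln (W 0 * exp (K * V 0) * (Z 0)\<^sup>2)"
      using max[of s] that p pos by (subst ln_le_cancel_iff) auto
    then show ?thesis
      using p pos by (simp add: ln_mult ln_realpow)
  qed
  have dpos: "0 < min d d1" using d d1 by auto
  note t = derivative_tests_at_local_max[OF dpos 1 2 3]
  define w where "w = W1 0 / W 0"
  define z where "z = Z1 0 / Z 0"
  have w: "w = - (K * V1 0 + 2 * z)"
    using t(1) by (simp add: w_def z_def)
  have "(W2 * W 0 - W1 0 * W1 0) / (W 0 * W 0) = W2 / W 0 - w\<^sup>2"
    "(Z2 * Z 0 - Z1 0 * Z1 0) / (Z 0 * Z 0) = Z2 / Z 0 - z\<^sup>2"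
    using pos by (simp_all add: w_def z_def field_simps power2_eq_square)
  with t(2) have "W2 / W 0 + K * V2 + 2 * (Z2 / Z 0) \<le> w\<^sup>2 + 2 * z\<^sup>2"
    by (simp add: algebra_simps)
  also have "\<dots> \<le> 2 * K\<^sup>2 * (V1 0)\<^sup>2 + 10 * z\<^sup>2"
    using sum_squares_bound[of "K * V1 0" "2 * z"]
    by (simp add: w power2_eq_square algebra_simps)
  finally show ?thesis by (simp add: z_def)
qed

section \<open>The differentiated equation\<close>

text \<open>
  The system in coordinate-free form: \<open>B\<close> and \<open>D3\<close> are the first and second spatial derivatives of \<open>Du\<close>,
  \<open>At\<close> is its time derivative and \<open>ut\<close> that of \<open>u\<close>. With \<open>\<sigma>\<^sub>m\<close> the \<open>m\<close>-th column of \<open>\<sigma>\<close>, the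
  second-order term \<open>tr(a D\<^sup>2u)\<close> is \<open>1/2 \<Sum>\<^sub>m D\<^sup>2u(\<sigma>\<^sub>m,\<sigma>\<^sub>m)\<close>; in this form the maximum principle reduces
  to one-dimensional derivative tests in the directions \<open>\<sigma>\<^sub>m\<close>. At time \<open>T\<close> itself the equation is not
  available, hence the half-open time intervals.
\<close>
locale smooth_solution =
  fixes T L\<sigma> C\<sigma> Cf \<epsilon> :: real
    and \<sigma> :: "real \<Rightarrow> real^'d \<Rightarrow> real^'n::{finite,linorder} \<Rightarrow> real^'d^'d"
    and f :: "real \<Rightarrow> real^'d \<Rightarrow> real^'n::{finite,linorder} \<Rightarrow> real^'d^'n::{finite,linorder} \<Rightarrow> real^'n::{finite,linorder}"
    and u :: "real \<Rightarrow> real^'d \<Rightarrow> real^'n::{finite,linorder}"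
    and ut :: "real \<Rightarrow> real^'d \<Rightarrow> real^'n::{finite,linorder}"
    and At :: "real \<Rightarrow> real^'d \<Rightarrow> real^'d^'n::{finite,linorder}"
    and B :: "real \<Rightarrow> real^'d \<Rightarrow> (real^'d) \<Rightarrow>\<^sub>L (real^'d^'n::{finite,linorder})"
    and D3 :: "real \<Rightarrow> real^'d \<Rightarrow> (real^'d) \<Rightarrow>\<^sub>L (real^'d) \<Rightarrow>\<^sub>L (real^'d^'n::{finite,linorder})"
  assumes T_pos: "0 < T"
    and sigma: "sigma_cond T L\<sigma> C\<sigma> \<sigma>"
    and f: "f_cond T Cf \<epsilon> f"
    and sigma_diff: "\<And>t z. t \<in> {0..T} \<Longrightarrow> (\<lambda>(x, v). \<sigma> t x v) differentiable (at z)"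
    and f_diff: "\<And>t z. t \<in> {0..T} \<Longrightarrow> (\<lambda>(x, v, p). f t x v p) differentiable (at z)"
    and u_cont: "continuous_on ({0..T} \<times> UNIV) (\<lambda>(t, x). u t x)"
    and u_bounded: "bounded ((\<lambda>(t, x). u t x) ` ({0..T} \<times> UNIV))"
    and Du_bounded: "bounded ((\<lambda>(t, x). Dx u t x) ` ({0..T} \<times> UNIV))"
    and Du_cont: "continuous_on ({0..T} \<times> UNIV) (\<lambda>(t, x). Dx u t x)"
    and u_x: "\<And>t x. t \<in> {0..T} \<Longrightarrow> (u t has_derivative (*v) (Dx u t x)) (at x)"
    and u_t: "\<And>t x. t \<in> {0..<T} \<Longrightarrow> ((\<lambda>s. u s x) has_vector_derivative ut t x) (at t within {0..<T})"
    and Du_x: "\<And>t x. t \<in> {0..T} \<Longrightarrow> (Dx u t has_derivative B t x) (at x)"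
    and Du_t: "\<And>t x. t \<in> {0..<T} \<Longrightarrow>
      ((\<lambda>s. Dx u s x) has_vector_derivative At t x) (at t within {0..<T})"
    and Du_xx: "\<And>t x. t \<in> {0..T} \<Longrightarrow> (B t has_derivative D3 t x) (at x)"
    and At_cont: "continuous_on ({0..T} \<times> UNIV) (\<lambda>(t, x). At t x)"
    and D3_cont: "\<And>t. t \<in> {0..T} \<Longrightarrow> continuous_on UNIV (D3 t)"
    and pde: "\<And>t x. t \<in> {0..<T} \<Longrightarrow>
      ut t x + (1 / 2) *\<^sub>R (\<Sum>m\<in>UNIV. B t x (\<sigma> t x (u t x) *v axis m 1) *v (\<sigma> t x (u t x) *v axis m 1))
        + f t x (u t x) (Dx u t x) = 0"
begin

definition S :: "real \<Rightarrow> real^'d \<Rightarrow> real^'d^'d" where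
  "S t x = \<sigma> t x (u t x)"

text \<open>
  The Euclidean norm of \<open>D\<^sup>2u\<close>.
\<close>
definition \<beta> :: "real \<Rightarrow> real^'d \<Rightarrow> real" where
  "\<beta> t x = sqrt (\<Sum>k\<in>UNIV. (norm (B t x (axis k 1)))\<^sup>2)"

lemma beta_nonneg: "0 \<le> \<beta> t x"
  by (simp add: \<beta>_def sum_nonneg)

lemma B_norm_le: "norm (B t x z) \<le> \<beta> t x * norm z"
  unfolding \<beta>_def by (rule norm_linear_le_sum_axis) (simp add: blinfun.bounded_linear_right bounded_linear.linear)

lemma pos: "0 < L\<sigma>" "0 < C\<sigma>" "0 < Cf"
  using sigma f by (auto simp: sigma_cond_def f_cond_def)

lemma S_sym: "t \<in> {0..T} \<Longrightarrow> transpose (S t x) = S t x"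
  using sigma by (auto simp: sigma_cond_def S_def)

lemma S_lower: "t \<in> {0..T} \<Longrightarrow> 1 / C\<sigma> * (norm z)\<^sup>2 \<le> (norm (S t x *v z))\<^sup>2"
  using sigma unfolding sigma_cond_def S_def by blast

lemma S_upper: "t \<in> {0..T} \<Longrightarrow> (norm (S t x *v z))\<^sup>2 \<le> C\<sigma> * (norm z)\<^sup>2"
  using sigma unfolding sigma_cond_def S_def by blast

lemma S_column_sq_le: "t \<in> {0..T} \<Longrightarrow> (norm (S t x *v axis m 1))\<^sup>2 \<le> C\<sigma>"
  using S_upper[of t x "axis m 1"] by simp

lemma S_column_le: "t \<in> {0..T} \<Longrightarrow> norm (S t x *v axis m 1) \<le> sqrt C\<sigma>"
  using S_column_sq_le by (simp add: real_le_rsqrt)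

lemma S_diff_le:
  "t \<in> {0..T} \<Longrightarrow> norm (S t y - S t x) \<le> L\<sigma> * (norm (y - x) + norm (u t y - u t x))"
  using sigma unfolding sigma_cond_def S_def by blast

lemma S_differentiable:
  assumes "t \<in> {0..T}" shows "S t differentiable (at x)"
proof -
  have "(\<lambda>x. (x, u t x)) differentiable (at x)"
    using u_x[OF assms] has_derivative_Pair[OF has_derivative_ident] unfolding differentiable_def by blast
  from differentiable_chain_at[OF this sigma_diff[OF assms]] show ?thesis
    by (simp add: o_def S_def[abs_def])
qed

lemma S_derivative_le:
  assumes t: "t \<in> {0..T}" and S': "(S t has_derivative S') (at x)"
  shows "norm (S' e) \<le> L\<sigma> * (norm e + norm (Dx u t x *v e))"
proof (rule norm_derivative_le[OF S'])
  let ?k = "\<lambda>h. L\<sigma> * (norm e + norm ((u t (x + h *\<^sub>R e) - u t x) /\<^sub>R h))"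
  show "norm (S t (x + h *\<^sub>R e) - S t x) \<le> h * ?k h" if "0 < h" for h
  proof -
    define q where "q = norm ((u t (x + h *\<^sub>R e) - u t x) /\<^sub>R h)"
    have "norm (u t (x + h *\<^sub>R e) - u t x) = h * q"
      using that by (simp add: q_def)
    then show ?thesis
      using S_diff_le[OF t, of "x + h *\<^sub>R e" x] that
      unfolding q_def[symmetric] by (simp add: algebra_simps)
  qed
  show "(?k \<longlongrightarrow> L\<sigma> * (norm e + norm (Dx u t x *v e))) (at_right 0)"
    by (intro tendsto_intros difference_quotient_tendsto u_x t)
qed

definition F where
  "F t x = f t x (u t x) (Dx u t x)"

lemma F_differentiable:
  assumes "t \<in> {0..T}" shows "F t differentiable (at x)"
proof -
  have "(\<lambda>x. (x, u t x, Dx u t x)) differentiable (at x)"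
    using has_derivative_Pair[OF has_derivative_ident has_derivative_Pair[OF u_x[OF assms] Du_x[OF assms]]]
    unfolding differentiable_def by blast
  from differentiable_chain_at[OF this f_diff[OF assms]] show ?thesis
    by (simp add: o_def F_def[abs_def])
qed

lemma F_derivative_le:
  assumes t: "t \<in> {0..T}" and F': "(F t has_derivative F') (at x)"
  shows "norm (F' e) \<le> Cf * (1 + (norm (Dx u t x))\<^sup>2) * (norm e + norm (Dx u t x *v e))
    + Cf * (1 + norm (Dx u t x) + norm (Dx u t x)) * norm (B t x e)"
proof (rule norm_derivative_le[OF F'])
  let ?p = "\<lambda>h. Dx u t (x + h *\<^sub>R e)"
  let ?k = "\<lambda>h. Cf * (1 + (norm (?p h))\<^sup>2) * (norm e + norm ((u t (x + h *\<^sub>R e) - u t x) /\<^sub>R h))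
    + Cf * (1 + norm (?p h) + norm (Dx u t x)) * norm ((?p h - Dx u t x) /\<^sub>R h)"
  show "norm (F t (x + h *\<^sub>R e) - F t x) \<le> h * ?k h" if "0 < h" for h
  proof -
    let ?f = "f t x (u t x) (?p h)"
    have "norm (F t (x + h *\<^sub>R e) - F t x) \<le> norm (F t (x + h *\<^sub>R e) - ?f) + norm (?f - F t x)"
      by (rule order_trans[OF _ norm_triangle_ineq]) simp
    also have "norm (F t (x + h *\<^sub>R e) - ?f) \<le>
        Cf * (1 + (norm (?p h))\<^sup>2) * (norm (x + h *\<^sub>R e - x) + norm (u t (x + h *\<^sub>R e) - u t x))"
      using f t unfolding f_cond_def F_def by blast
    also have "norm (?f - F t x) \<le> Cf * (1 + norm (?p h) + norm (Dx u t x)) * norm (?p h - Dx u t x)"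
      using f t unfolding f_cond_def F_def by blast
    finally have le: "norm (F t (x + h *\<^sub>R e) - F t x) \<le>
        Cf * (1 + (norm (?p h))\<^sup>2) * (norm (x + h *\<^sub>R e - x) + norm (u t (x + h *\<^sub>R e) - u t x))
        + Cf * (1 + norm (?p h) + norm (Dx u t x)) * norm (?p h - Dx u t x)"
      by simp
    define q r where "q = norm ((u t (x + h *\<^sub>R e) - u t x) /\<^sub>R h)"
      and "r = norm ((?p h - Dx u t x) /\<^sub>R h)"
    have "norm (u t (x + h *\<^sub>R e) - u t x) = h * q" "norm (?p h - Dx u t x) = h * r"
      using that by (simp_all add: q_def r_def)
    then show ?thesis
      using le that unfolding q_def[symmetric] r_def[symmetric] by (simp add: algebra_simps)
  qed
  have "isCont (Dx u t) x"
    using Du_x[OF t] has_derivative_continuous by blast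
  then have "(Dx u t \<longlongrightarrow> Dx u t x) (nhds x)"
    by (simp add: isCont_def tendsto_at_iff_tendsto_nhds)
  moreover have "filterlim (\<lambda>h. x + h *\<^sub>R e) (nhds x) (at_right 0)"
    by (auto intro!: tendsto_eq_intros)
  ultimately have "(?p \<longlongrightarrow> Dx u t x) (at_right 0)"
    by (rule filterlim_compose)
  then show "(?k \<longlongrightarrow> Cf * (1 + (norm (Dx u t x))\<^sup>2) * (norm e + norm (Dx u t x *v e))
    + Cf * (1 + norm (Dx u t x) + norm (Dx u t x)) * norm (B t x e)) (at_right 0)"
    by (intro tendsto_intros difference_quotient_tendsto u_x Du_x t)
qed

lemma F_le:
  assumes t: "t \<in> {0..T}"
  shows "norm (F t x) \<le> 4 * real CARD('n) * Cf * (1 + (norm (Dx u t x))\<^sup>2)"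
proof -
  let ?p = "Dx u t x"
  have eps: "0 < \<epsilon>" "\<epsilon> < 1" using f by (auto simp: f_cond_def)
  have "\<bar>F t x $ i\<bar> \<le> 4 * Cf * (1 + (norm ?p)\<^sup>2)" for i
  proof -
    have "\<bar>F t x $ i\<bar> \<le> Cf * (1 + norm (?p $ i) * norm ?p + (\<Sum>j | j < i. (norm (?p $ j))\<^sup>2)
        + norm ?p powr (2 - \<epsilon>))"
      using f t unfolding f_cond_def F_def by blast
    also have "\<dots> \<le> Cf * (1 + (norm ?p)\<^sup>2 + (norm ?p)\<^sup>2 + (1 + (norm ?p)\<^sup>2))"
    proof (intro mult_left_mono add_mono order_refl)
      show "norm (?p $ i) * norm ?p \<le> (norm ?p)\<^sup>2"
        by (simp add: power2_eq_square mult_right_mono component_le_norm_cart Finite_Cartesian_Product.norm_nth_le)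
      show "(\<Sum>j | j < i. (norm (?p $ j))\<^sup>2) \<le> (norm ?p)\<^sup>2"
        unfolding norm_squared_vec_eq_sum[of ?p] by (intro sum_mono2) auto
      show "norm ?p powr (2 - \<epsilon>) \<le> 1 + (norm ?p)\<^sup>2"
      proof (cases "norm ?p \<le> 1")
        case True
        then have "norm ?p powr (2 - \<epsilon>) \<le> 1"
          using eps by (intro powr_le1) auto
        then show ?thesis by (simp add: add_increasing2)
      next
        case False
        then have "norm ?p powr (2 - \<epsilon>) \<le> norm ?p powr 2"
          using eps by (intro powr_mono) auto
        then show ?thesis using False by (simp add: powr_numeral)
      qed
    qed (use pos in auto)
    also have "\<dots> \<le> 4 * Cf * (1 + (norm ?p)\<^sup>2)"
      using pos by (simp add: algebra_simps)
    finally show ?thesis .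
  qed
  then have "(\<Sum>i\<in>UNIV. \<bar>F t x $ i\<bar>) \<le> (\<Sum>i\<in>(UNIV :: 'n set). 4 * Cf * (1 + (norm ?p)\<^sup>2))"
    by (intro sum_mono)
  then show ?thesis
    using norm_le_l1_cart[of "F t x"] by (simp add: mult.assoc mult.left_commute)
qed

lemma B_symmetric: "t \<in> {0..T} \<Longrightarrow> B t x e *v e' = B t x e' *v e"
proof (rule second_derivative_symmetric[of "u t"])
  assume t: "t \<in> {0..T}"
  show "(u t has_derivative (*v) (Dx u t x)) (at x)" for x by (rule u_x[OF t])
  show "((\<lambda>x. Dx u t x *v z) has_derivative (\<lambda>y. B t x y *v z)) (at x)" for x z
    by (rule bounded_linear.has_derivative[OF
          bounded_bilinear.bounded_linear_left[OF bounded_bilinear_matrix_vector] Du_x[OF t]])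
  have "continuous_on UNIV (B t)"
    using Du_xx[OF t] by (meson continuous_at_imp_continuous_on has_derivative_continuous)
  then show "continuous_on UNIV (\<lambda>x. B t x y *v z)" for y z
    by (intro bounded_bilinear.continuous_on[OF bounded_bilinear_matrix_vector] continuous_intros)
qed

lemma D3_derivative:
  "t \<in> {0..T} \<Longrightarrow> ((\<lambda>x. B t x z) has_derivative (\<lambda>y. D3 t x y z)) (at x)"
  by (rule bounded_linear.has_derivative[OF blinfun.bounded_linear_left Du_xx])

lemma D3_symmetric:
  assumes t: "t \<in> {0..T}" shows "D3 t x e e' = D3 t x e' e"
proof (rule second_derivative_symmetric[of "Dx u t"])
  show "(Dx u t has_derivative B t x) (at x)" for x by (rule Du_x[OF t])
  show "((\<lambda>x. B t x z) has_derivative (\<lambda>y. D3 t x y z)) (at x)" for x z by (rule D3_derivative[OF t])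
  show "continuous_on UNIV (\<lambda>x. D3 t x y z)" for y z
    by (intro continuous_intros D3_cont t)
qed

text \<open>
  Symmetry of \<open>D\<^sup>2u\<close>, differentiated once more.
\<close>
lemma D3_symmetric':
  assumes t: "t \<in> {0..T}" shows "D3 t x e a *v b = D3 t x e b *v a"
proof -
  have *: "((\<lambda>x. B t x a *v b) has_derivative (\<lambda>y. D3 t x y a *v b)) (at x)" for a b
    by (rule bounded_linear.has_derivative[OF
          bounded_bilinear.bounded_linear_left[OF bounded_bilinear_matrix_vector] D3_derivative[OF t]])
  from has_derivative_unique[OF *[of a b] *[of b a, unfolded B_symmetric[OF t, of _ b a]]]
  show ?thesis by (auto dest: fun_cong)
qed

lemma D3_rotate: "t \<in> {0..T} \<Longrightarrow> D3 t x e a *v a = D3 t x a a *v e"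
  by (metis D3_symmetric D3_symmetric')

lemma mixed_derivative_ut:
  assumes t: "t \<in> {0..<T}" and ut': "(ut t has_derivative ut') (at x)"
  shows "ut' e = At t x *v e"
proof -
  have 1: "((\<lambda>h. ut t (x + h *\<^sub>R e)) has_vector_derivative At t (x + 0 *\<^sub>R e) *v e) (at 0 within {0..1})"
  proof (rule mixed_derivative[where I = "{0..<T}" and \<phi> = "\<lambda>s h. u s (x + h *\<^sub>R e)"
        and a = "\<lambda>s h. Dx u s (x + h *\<^sub>R e) *v e" and b = "\<lambda>s h. At s (x + h *\<^sub>R e) *v e"])
    show "((\<lambda>h. u s (x + h *\<^sub>R e)) has_vector_derivative Dx u s (x + h *\<^sub>R e) *v e) (at h within {0..1})"
      if "s \<in> {0..<T}" for s h
      using that by (intro has_vector_derivative_along_line u_x) auto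
    show "((\<lambda>s. Dx u s (x + h *\<^sub>R e) *v e) has_vector_derivative At s (x + h *\<^sub>R e) *v e) (at s within {0..<T})"
      if "s \<in> {0..<T}" for s h
      by (rule bounded_linear.has_vector_derivative[OF
          bounded_bilinear.bounded_linear_left[OF bounded_bilinear_matrix_vector] Du_t[OF that]])
    show "continuous_on ({0..<T} \<times> {0..1}) (\<lambda>(s, h). At s (x + h *\<^sub>R e) *v e)"
      unfolding case_prod_unfold
      by (intro bounded_bilinear.continuous_on[OF bounded_bilinear_matrix_vector] continuous_on_const
            continuous_on_compose2[OF At_cont, where f = "\<lambda>z. (fst z, x + snd z *\<^sub>R e)",
              unfolded case_prod_unfold fst_conv snd_conv] continuous_intros) auto
  qed (use t at_within_Ico_neq_bot u_t in auto)
  have 2: "((\<lambda>h. ut t (x + h *\<^sub>R e)) has_vector_derivative ut' e) (at 0 within {0..1})"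
    using has_vector_derivative_along_line[where x = x and s = 0 and e = e] ut' by simp
  have "at (0::real) within {0..1} \<noteq> bot"
    by (simp add: at_within_Icc_at_right trivial_limit_at_right_real)
  from vector_derivative_unique_within[OF this 1 2] show ?thesis by simp
qed

text \<open>
  The linear operator \<open>\<partial>\<^sub>t + tr(a D\<^sup>2)\<close>, with \<open>a\<close> evaluated along \<open>u\<close>, applied to \<open>Du\<close>.
\<close>
definition heat_Du :: "real \<Rightarrow> real^'d \<Rightarrow> real^'d^'n::{finite,linorder}" where
  "heat_Du t x = At t x + (1 / 2) *\<^sub>R (\<Sum>m\<in>UNIV. D3 t x (S t x *v axis m 1) (S t x *v axis m 1))"

text \<open>
  Differentiating the equation in direction \<open>e\<close> expresses \<open>heat_Du\<close> by the derivative of the columns of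
  \<open>\<sigma>\<close> and of the right-hand side along \<open>u\<close>: the third derivatives match because they are symmetric.
  The derivative of \<open>\<sigma>\<close> is at most \<open>L\<sigma> (1 + |Du|)\<close> and is multiplied by \<open>D\<^sup>2u\<close>; the derivative of
  \<open>f\<close> contributes one cubic term in \<open>|Du|\<close> and one term linear in \<open>D\<^sup>2u\<close>.
\<close>
lemma norm_heat_Du_column_le:
  assumes t: "t \<in> {0..<T}" and e: "norm e = 1"
  shows "norm (heat_Du t x *v e) \<le> real CARD('d) * (\<beta> t x * (L\<sigma> * (1 + norm (Dx u t x))) * sqrt C\<sigma>)
    + Cf * (1 + (norm (Dx u t x))\<^sup>2) * (1 + norm (Dx u t x))
    + Cf * (1 + 2 * norm (Dx u t x)) * \<beta> t x"
proof -
  have t': "t \<in> {0..T}" using t by auto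
  obtain S' where S': "(S t has_derivative S') (at x)"
    using S_differentiable[OF t'] unfolding differentiable_def by blast
  obtain F' where F': "(F t has_derivative F') (at x)"
    using F_differentiable[OF t'] unfolding differentiable_def by blast
  define s where "s m = S t x *v axis m 1" for m
  define s' where "s' m = S' e *v axis m 1" for m
  have Sa: "((\<lambda>x. S t x *v a) has_derivative (\<lambda>e. S' e *v a)) (at x)" for a
    by (rule bounded_linear.has_derivative[OF
          bounded_bilinear.bounded_linear_left[OF bounded_bilinear_matrix_vector] S'])
  define Q where "Q m y = B t y (S t y *v axis m 1) *v (S t y *v axis m 1)" for m y
  define Q' where "Q' m e = B t x (S t x *v axis m 1) *v (S' e *v axis m 1)
      + (B t x (S' e *v axis m 1) + D3 t x e (S t x *v axis m 1)) *v (S t x *v axis m 1)" for m e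
  have Q: "(Q m has_derivative Q' m) (at x)" for m
    unfolding Q_def[abs_def] Q'_def[abs_def]
    by (rule bounded_bilinear.FDERIV[OF bounded_bilinear_matrix_vector
          blinfun.FDERIV[OF Du_xx[OF t'] Sa] Sa])
  have ut_eq: "ut t = (\<lambda>y. - ((1 / 2) *\<^sub>R (\<Sum>m\<in>UNIV. Q m y)) - F t y)"
  proof
    fix y
    from pde[OF t, of y]
    show "ut t y = - ((1 / 2) *\<^sub>R (\<Sum>m\<in>UNIV. Q m y)) - F t y"
      unfolding S_def[symmetric] F_def[symmetric] Q_def[symmetric]
      by (simp add: eq_neg_iff_add_eq_0 eq_diff_eq add_ac)
  qed
  \<comment> \<open>The equation exhibits \<open>ut t\<close> as a differentiable function of \<open>x\<close>, which is what allows to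
      exchange the time and the space derivative.\<close>
  have "((\<lambda>y. \<Sum>m\<in>UNIV. Q m y) has_derivative (\<lambda>e. \<Sum>m\<in>UNIV. Q' m e)) (at x)"
    by (rule has_derivative_sum) (rule Q)
  then have "(ut t has_derivative (\<lambda>e. - ((1 / 2) *\<^sub>R (\<Sum>m\<in>UNIV. Q' m e)) - F' e)) (at x)"
    unfolding ut_eq by (intro has_derivative_diff has_derivative_minus has_derivative_scaleR_right F')
  from mixed_derivative_ut[OF t this, of e]
  have "At t x *v e = - ((1 / 2) *\<^sub>R (\<Sum>m\<in>UNIV. B t x (s m) *v s' m
      + (B t x (s' m) + D3 t x e (s m)) *v s m)) - F' e"
    unfolding s_def s'_def Q'_def by simp
  also have "\<dots> = - ((1 / 2) *\<^sub>R (\<Sum>m\<in>UNIV. D3 t x (s m) (s m)) *v e)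
      - (1 / 2) *\<^sub>R (\<Sum>m\<in>UNIV. B t x (s m) *v s' m + B t x (s' m) *v s m) - F' e"
  proof -
    have "(\<Sum>m\<in>UNIV. D3 t x (s m) (s m)) *v e = (\<Sum>m\<in>UNIV. D3 t x e (s m) *v s m)"
      by (subst sum.cong[OF refl D3_rotate[OF t']])
        (rule linear_sum[OF bounded_linear.linear[OF
            bounded_bilinear.bounded_linear_left[OF bounded_bilinear_matrix_vector]]])
    then show ?thesis
      unfolding scaleR_matrix_vector_assoc[symmetric] matrix_vector_mult_add_rdistrib sum.distrib
      by (simp add: scaleR_add_right)
  qed
  finally have "heat_Du t x *v e = - ((1 / 2) *\<^sub>R (\<Sum>m\<in>UNIV. B t x (s m) *v s' m + B t x (s' m) *v s m) + F' e)"
    unfolding heat_Du_def s_def[symmetric] by (simp add: matrix_vector_mult_add_rdistrib)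
  then have "norm (heat_Du t x *v e) = norm ((1 / 2) *\<^sub>R (\<Sum>m\<in>UNIV. B t x (s m) *v s' m + B t x (s' m) *v s m) + F' e)"
    by (simp only: norm_minus_cancel)
  also have "\<dots> \<le> 1 / 2 * norm (\<Sum>m\<in>UNIV. B t x (s m) *v s' m + B t x (s' m) *v s m) + norm (F' e)"
    by (rule order_trans[OF norm_triangle_ineq]) simp
  also have "norm (\<Sum>m\<in>UNIV. B t x (s m) *v s' m + B t x (s' m) *v s m) \<le>
      (\<Sum>m\<in>(UNIV :: 'd set). 2 * (\<beta> t x * (L\<sigma> * (1 + norm (Dx u t x))) * sqrt C\<sigma>))"
  proof (rule sum_norm_le)
    fix m
    have "norm (Dx u t x *v e) \<le> norm (Dx u t x)"
      using norm_matrix_vector_mult_le[of "Dx u t x" e] e by simp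
    then have "L\<sigma> * (norm e + norm (Dx u t x *v e)) \<le> L\<sigma> * (1 + norm (Dx u t x))"
      using e pos by (intro mult_left_mono) auto
    then have "norm (S' e) \<le> L\<sigma> * (1 + norm (Dx u t x))"
      using S_derivative_le[OF t' S', of e] by linarith
    moreover have "norm (s' m) \<le> norm (S' e)"
      using norm_matrix_vector_mult_le[of "S' e" "axis m 1"] by (simp add: s'_def)
    ultimately have s': "norm (s' m) \<le> L\<sigma> * (1 + norm (Dx u t x))" by simp
    have s: "norm (s m) \<le> sqrt C\<sigma>" using S_column_le[OF t'] by (simp add: s_def)
    have prod: "norm (B t x y *v z) \<le> \<beta> t x * norm y * norm z" for y z
      using norm_matrix_vector_mult_le[of "B t x y" z] B_norm_le[of t x y]
      by (meson mult_right_mono norm_ge_zero order_trans)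
    have "norm (s m) * norm (s' m) \<le> sqrt C\<sigma> * (L\<sigma> * (1 + norm (Dx u t x)))"
      using s s' pos by (intro mult_mono) auto
    then have "\<beta> t x * (norm (s m) * norm (s' m)) \<le> \<beta> t x * (sqrt C\<sigma> * (L\<sigma> * (1 + norm (Dx u t x))))"
      by (rule mult_left_mono[OF _ beta_nonneg])
    then show "norm (B t x (s m) *v s' m + B t x (s' m) *v s m) \<le>
        2 * (\<beta> t x * (L\<sigma> * (1 + norm (Dx u t x))) * sqrt C\<sigma>)"
      using prod[of "s m" "s' m"] prod[of "s' m" "s m"]
      by (intro order_trans[OF norm_triangle_ineq]) (simp add: mult_ac)
  qed
  also have "norm (F' e) \<le> Cf * (1 + (norm (Dx u t x))\<^sup>2) * (1 + norm (Dx u t x))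
    + Cf * (1 + 2 * norm (Dx u t x)) * \<beta> t x"
  proof -
    have "norm (Dx u t x *v e) \<le> norm (Dx u t x)" "norm (B t x e) \<le> \<beta> t x"
      using norm_matrix_vector_mult_le[of "Dx u t x" e] B_norm_le[of t x e] e by auto
    then have "Cf * (1 + (norm (Dx u t x))\<^sup>2) * (norm e + norm (Dx u t x *v e))
      + Cf * (1 + norm (Dx u t x) + norm (Dx u t x)) * norm (B t x e)
      \<le> Cf * (1 + (norm (Dx u t x))\<^sup>2) * (1 + norm (Dx u t x))
      + Cf * (1 + norm (Dx u t x) + norm (Dx u t x)) * \<beta> t x"
      using e pos by (intro add_mono mult_left_mono) auto
    then show ?thesis using F_derivative_le[OF t' F', of e] by (simp add: add.commute)
  qed
  finally show ?thesis by simp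
qed

text \<open>
  The factor of \<open>|Du| |D\<^sup>2u|\<close> in the bound for each column of \<open>heat_Du\<close> when \<open>|Du| \<ge> 1\<close>.
\<close>
definition coupling :: real where
  "coupling = 2 * real CARD('d) * L\<sigma> * sqrt C\<sigma> + 3 * Cf"

definition gradient_loss :: real where
  "gradient_loss = C\<sigma> * (real CARD('d))\<^sup>2 * coupling\<^sup>2 + 8 * real CARD('d) * Cf"

lemma norm_heat_Du_le:
  assumes t: "t \<in> {0..<T}" and a: "1 \<le> norm (Dx u t x)"
  defines "a \<equiv> norm (Dx u t x)"
  shows "norm (heat_Du t x) \<le> real CARD('d) * (coupling * a * \<beta> t x + 4 * Cf * a ^ 3)"
proof -
  have a1: "1 \<le> a" using a by (simp add: a_def)
  have b: "0 \<le> \<beta> t x" by (rule beta_nonneg)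
  have "norm (heat_Du t x) \<le> (\<Sum>k\<in>UNIV. norm (heat_Du t x *v axis k 1))"
    by (rule norm_le_sum_columns)
  also have "\<dots> \<le> (\<Sum>k\<in>(UNIV :: 'd set). coupling * a * \<beta> t x + 4 * Cf * a ^ 3)"
  proof (rule sum_mono)
    fix k :: 'd
    have "norm (heat_Du t x *v axis k 1) \<le> real CARD('d) * (\<beta> t x * (L\<sigma> * (1 + a)) * sqrt C\<sigma>)
        + Cf * (1 + a\<^sup>2) * (1 + a) + Cf * (1 + 2 * a) * \<beta> t x"
      unfolding a_def by (rule norm_heat_Du_column_le[OF t]) simp
    also have "\<dots> \<le> real CARD('d) * (\<beta> t x * (L\<sigma> * (a + a)) * sqrt C\<sigma>)
        + Cf * (a\<^sup>2 + a\<^sup>2) * (a + a) + Cf * (a + 2 * a) * \<beta> t x"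
      using a1 b pos by (intro add_mono mult_mono order_refl mult_nonneg_nonneg) auto
    also have "\<dots> = coupling * a * \<beta> t x + 4 * Cf * a ^ 3"
      by (simp add: coupling_def algebra_simps power2_eq_square power3_eq_cube)
    finally show "norm (heat_Du t x *v axis k 1) \<le> coupling * a * \<beta> t x + 4 * Cf * a ^ 3" .
  qed
  finally show ?thesis by simp
qed

text \<open>
  The left-hand side is \<open>(\<partial>\<^sub>t + tr(a D\<^sup>2)) |Du|\<^sup>2\<close>. Ellipticity makes the sum at least \<open>\<beta>\<^sup>2 / C\<sigma>\<close>, which
  absorbs the term \<open>|Du|\<^sup>2 \<beta>\<close> coming from the differentiated equation by completing the square.
\<close>
lemma gradient_energy_lower_bound:
  assumes t: "t \<in> {0..<T}" and a: "1 \<le> norm (Dx u t x)"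
  shows "(\<Sum>m\<in>UNIV. (norm (B t x (S t x *v axis m 1)))\<^sup>2) + 2 * (Dx u t x \<bullet> heat_Du t x)
    \<ge> - gradient_loss * (norm (Dx u t x)) ^ 4"
proof -
  define a where "a = norm (Dx u t x)"
  define b where "b = \<beta> t x"
  define k where "k = real CARD('d) * coupling"
  have t': "t \<in> {0..T}" using t by auto
  have "1 / C\<sigma> * (\<Sum>k\<in>UNIV. (norm (B t x (axis k 1)))\<^sup>2) \<le> (\<Sum>m\<in>UNIV. (norm (B t x (S t x *v axis m 1)))\<^sup>2)"
    by (rule elliptic_sum_lower_bound)
       (auto simp: blinfun.bounded_linear_right bounded_linear.linear S_sym[OF t'] intro: S_lower[OF t', simplified])
  then have 1: "b\<^sup>2 / C\<sigma> \<le> (\<Sum>m\<in>UNIV. (norm (B t x (S t x *v axis m 1)))\<^sup>2)"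
    by (simp add: b_def \<beta>_def sum_nonneg)
  have "\<bar>Dx u t x \<bullet> heat_Du t x\<bar> \<le> a * norm (heat_Du t x)"
    unfolding a_def by (rule Cauchy_Schwarz_ineq2)
  also have "\<dots> \<le> a * (real CARD('d) * (coupling * a * b + 4 * Cf * a ^ 3))"
    using norm_heat_Du_le[OF t a] by (intro mult_left_mono) (auto simp: a_def b_def)
  also have "\<dots> = k * a\<^sup>2 * b + 4 * real CARD('d) * Cf * a ^ 4"
    by (simp add: k_def algebra_simps power2_eq_square power3_eq_cube power4_eq_xxxx)
  finally have 2: "2 * (Dx u t x \<bullet> heat_Du t x) \<ge> - 2 * (k * a\<^sup>2 * b) - 8 * real CARD('d) * Cf * a ^ 4"
    by linarith
  \<comment> \<open>Completing the square: the mixed term \<open>2 k a\<^sup>2 b\<close> is absorbed by \<open>b\<^sup>2 / C\<sigma>\<close>.\<close>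
  have "0 \<le> (b - C\<sigma> * k * a\<^sup>2)\<^sup>2 / C\<sigma>"
    using pos by simp
  also have "\<dots> = b\<^sup>2 / C\<sigma> - 2 * (k * a\<^sup>2 * b) + C\<sigma> * k\<^sup>2 * a ^ 4"
    using pos by (simp add: field_simps power2_eq_square power4_eq_xxxx)
  finally have 3: "0 \<le> b\<^sup>2 / C\<sigma> - 2 * (k * a\<^sup>2 * b) + C\<sigma> * k\<^sup>2 * a ^ 4" .
  have "gradient_loss * a ^ 4 = C\<sigma> * k\<^sup>2 * a ^ 4 + 8 * real CARD('d) * Cf * a ^ 4"
    by (simp add: gradient_loss_def k_def algebra_simps power_mult_distrib)
  with 1 2 3 show ?thesis unfolding a_def by linarith
qed

text \<open>
  The left-hand side is \<open>(\<partial>\<^sub>t + tr(a D\<^sup>2)) |u - \<xi>|\<^sup>2\<close>. By the equation it equals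
  \<open>\<Sum>\<^sub>m |Du \<sigma>\<^sub>m|\<^sup>2 - 2 (u - \<xi>) \<bullet> f\<close>; the quadratic growth of \<open>f\<close> is harmless since it is multiplied by the
  small factor \<open>|u - \<xi>|\<close>.
\<close>
lemma oscillation_energy_lower_bound:
  assumes t: "t \<in> {0..<T}" and a: "1 \<le> norm (Dx u t x)"
    and \<delta>: "norm (u t x - \<xi>) \<le> \<delta>" "32 * real CARD('n) * Cf * \<delta> * C\<sigma> \<le> 1"
  shows "2 * ((u t x - \<xi>) \<bullet> ut t x) + (1 / 2) * (\<Sum>m\<in>UNIV.
      2 * (norm (Dx u t x *v (S t x *v axis m 1)))\<^sup>2
      + 2 * ((u t x - \<xi>) \<bullet> (B t x (S t x *v axis m 1) *v (S t x *v axis m 1))))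
    \<ge> (norm (Dx u t x))\<^sup>2 / (2 * C\<sigma>)"
proof -
  have t': "t \<in> {0..T}" using t by auto
  define w where "w = (norm (Dx u t x))\<^sup>2"
  define X where "X = (\<Sum>m\<in>UNIV. B t x (S t x *v axis m 1) *v (S t x *v axis m 1))"
  have ut: "ut t x + (1 / 2) *\<^sub>R X = - F t x"
    using pde[OF t, of x] unfolding X_def S_def F_def by (simp add: eq_neg_iff_add_eq_0)
  have "2 * ((u t x - \<xi>) \<bullet> ut t x) + (1 / 2) * (\<Sum>m\<in>UNIV.
      2 * (norm (Dx u t x *v (S t x *v axis m 1)))\<^sup>2
      + 2 * ((u t x - \<xi>) \<bullet> (B t x (S t x *v axis m 1) *v (S t x *v axis m 1))))
    = (\<Sum>m\<in>UNIV. (norm (Dx u t x *v (S t x *v axis m 1)))\<^sup>2)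
      + 2 * ((u t x - \<xi>) \<bullet> (ut t x + (1 / 2) *\<^sub>R X))"
    by (simp add: X_def sum.distrib sum_distrib_left[symmetric] inner_add_right inner_sum_right)
  also have "\<dots> = (\<Sum>m\<in>UNIV. (norm (Dx u t x *v (S t x *v axis m 1)))\<^sup>2) - 2 * ((u t x - \<xi>) \<bullet> F t x)"
    by (simp add: ut)
  finally have eq: "2 * ((u t x - \<xi>) \<bullet> ut t x) + (1 / 2) * (\<Sum>m\<in>UNIV.
      2 * (norm (Dx u t x *v (S t x *v axis m 1)))\<^sup>2
      + 2 * ((u t x - \<xi>) \<bullet> (B t x (S t x *v axis m 1) *v (S t x *v axis m 1))))
    = (\<Sum>m\<in>UNIV. (norm (Dx u t x *v (S t x *v axis m 1)))\<^sup>2) - 2 * ((u t x - \<xi>) \<bullet> F t x)" .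
  have 1: "w / C\<sigma> \<le> (\<Sum>m\<in>UNIV. (norm (Dx u t x *v (S t x *v axis m 1)))\<^sup>2)"
    using elliptic_sum_lower_bound[of "(*v) (Dx u t x)" "S t x" "1 / C\<sigma>"] S_lower[OF t', of _ x] S_sym[OF t', of x]
    by (simp add: w_def norm_squared_eq_sum_columns[of "Dx u t x"] matrix_vector_mul_linear)
  have w1: "1 \<le> w" using a by (simp add: w_def)
  have d0: "0 \<le> \<delta>" using \<delta>(1) norm_ge_zero order_trans by blast
  have "(u t x - \<xi>) \<bullet> F t x \<le> norm (u t x - \<xi>) * norm (F t x)"
    by (rule norm_cauchy_schwarz)
  also have "\<dots> \<le> \<delta> * (4 * real CARD('n) * Cf * (1 + w))"
    using \<delta>(1) d0 F_le[OF t', of x] by (intro mult_mono) (auto simp: w_def)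
  also have "\<dots> \<le> \<delta> * (4 * real CARD('n) * Cf * (w + w))"
    using w1 d0 pos by (intro mult_left_mono add_right_mono) auto
  also have "\<dots> = (32 * real CARD('n) * Cf * \<delta> * C\<sigma>) * (w / (4 * C\<sigma>))"
    using pos by (simp add: field_simps)
  also have "\<dots> \<le> 1 * (w / (4 * C\<sigma>))"
    using \<delta>(2) w1 pos by (intro mult_right_mono) auto
  finally have "2 * ((u t x - \<xi>) \<bullet> F t x) \<le> w / (2 * C\<sigma>)" by simp
  then have "w / (2 * C\<sigma>) \<le> w / C\<sigma> - 2 * ((u t x - \<xi>) \<bullet> F t x)"
    by (simp add: field_simps)
  with 1 show ?thesis unfolding eq w_def[symmetric] by linarith
qed

section \<open>The weighted, localised gradient at its maximum\<close>

text \<open>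
  The constant \<open>K\<close> of the exponential weight. The gain \<open>K w / (2 C\<sigma>)\<close> then exceeds the loss
  \<open>gradient_loss * w\<close> by \<open>2 w\<close>; one of the two is spent on \<open>K\<^sup>2 |D|u - \<xi>|\<^sup>2|\<^sup>2\<close>.
\<close>
definition weight :: real where "weight = 2 * C\<sigma> * (gradient_loss + 2)"

text \<open>
  An upper bound for the trace of \<open>\<sigma>\<sigma>\<^sup>T\<close>.
\<close>
definition trace_bound :: real where "trace_bound = real CARD('d) * C\<sigma>"

lemma sum_columns_sq_le:
  assumes "t \<in> {0..T}" shows "(\<Sum>m\<in>UNIV. (norm (S t x *v axis m 1))\<^sup>2) \<le> trace_bound"
  using sum_mono[of "UNIV :: 'd set", OF S_column_sq_le[OF assms, of x]] by (simp add: trace_bound_def)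

lemma trace_bound_pos: "0 < trace_bound" using pos by (simp add: trace_bound_def)

lemma gradient_loss_nonneg: "0 \<le> gradient_loss" using pos by (simp add: gradient_loss_def)

lemma weight_pos: "0 < weight" using pos gradient_loss_nonneg by (simp add: weight_def add_nonneg_pos)

text \<open>
  Half the sum over \<open>m\<close> of the second-order conditions in the directions \<open>\<sigma>\<^sub>m\<close>, plus the first-order
  condition in time, is \<open>\<partial>\<^sub>t + tr(a D\<^sup>2)\<close> of the logarithm of \<open>\<Phi>\<close>, up to the squared gradients. The
  time derivative only has to be taken from the right, so that a maximum at the initial time \<open>t0\<close>
  is covered as well.
\<close>
lemma interior_maximum_bound:
  fixes x0 :: "real^'d" and \<xi> :: "real^'n::{finite,linorder}" and t0 r :: real
  defines "\<psi> \<equiv> \<lambda>t x. r\<^sup>2 - (norm (x - x0))\<^sup>2 - (t - t0)"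
  defines "\<Phi> \<equiv> \<lambda>t x. (norm (Dx u t x))\<^sup>2 * exp (weight * (norm (u t x - \<xi>))\<^sup>2) * (\<psi> t x)\<^sup>2"
  assumes t1: "t1 \<in> {0..<T}" "t0 \<le> t1" and pos1: "0 < \<psi> t1 x1"
    and \<delta>: "norm (u t1 x1 - \<xi>) \<le> \<delta>" "32 * real CARD('n) * Cf * \<delta> * C\<sigma> \<le> 1" "4 * weight\<^sup>2 * \<delta>\<^sup>2 * trace_bound \<le> 1"
    and a: "1 \<le> norm (Dx u t1 x1)"
    and max: "\<And>t x. t \<in> {t1..T} \<Longrightarrow> 0 \<le> \<psi> t x \<Longrightarrow> \<Phi> t x \<le> \<Phi> t1 x1"
  shows "(norm (Dx u t1 x1))\<^sup>2 * (\<psi> t1 x1)\<^sup>2 \<le> (2 + 22 * trace_bound) * r\<^sup>2"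
proof -
  have t1': "t1 \<in> {0..T}" using t1 by auto
  define w where "w = (norm (Dx u t1 x1))\<^sup>2"
  define p where "p = \<psi> t1 x1"
  have w1: "1 \<le> w" using a by (simp add: w_def)
  have p: "0 < p" using pos1 by (simp add: p_def)
  have xr: "(norm (x1 - x0))\<^sup>2 \<le> r\<^sup>2" and pr: "p \<le> r\<^sup>2"
    using pos1 t1 zero_le_power2[of "norm (x1 - x0)"] unfolding \<psi>_def p_def by linarith+
  define e where "e m = S t1 x1 *v axis m 1" for m
  define W2 where "W2 m = 2 * (norm (B t1 x1 (e m)))\<^sup>2 + 2 * (Dx u t1 x1 \<bullet> D3 t1 x1 (e m) (e m))" for m
  define V2 where "V2 m = 2 * (norm (Dx u t1 x1 *v e m))\<^sup>2 + 2 * ((u t1 x1 - \<xi>) \<bullet> (B t1 x1 (e m) *v e m))" for m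
  have space: "W2 m / w + weight * V2 m - 4 * ((norm (e m))\<^sup>2 / p)
      \<le> 8 * weight\<^sup>2 * \<delta>\<^sup>2 * C\<sigma> * w + 40 * r\<^sup>2 * C\<sigma> / p\<^sup>2" for m
  proof -
    let ?x = "\<lambda>s. x1 + s *\<^sub>R e m"
    let ?A = "\<lambda>s. Dx u t1 (?x s)"
    have dA: "((\<lambda>s. ?A s) has_vector_derivative B t1 (?x s) (e m)) (at s)" for s
      by (rule has_vector_derivative_along_line[OF Du_x[OF t1']])
    have dB: "((\<lambda>s. B t1 (?x s) (e m)) has_vector_derivative D3 t1 (?x s) (e m) (e m)) (at s)" for s
      by (rule has_vector_derivative_along_line[OF D3_derivative[OF t1']])
    have du: "((\<lambda>s. u t1 (?x s) - \<xi>) has_vector_derivative ?A s *v e m) (at s)" for s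
      using has_vector_derivative_along_line[OF u_x[OF t1']]
      by (auto intro!: derivative_eq_intros)
    have dAe: "((\<lambda>s. ?A s *v e m) has_vector_derivative B t1 (?x s) (e m) *v e m) (at s)" for s
      by (rule bounded_linear.has_vector_derivative[OF
          bounded_bilinear.bounded_linear_left[OF bounded_bilinear_matrix_vector] dA])
    have dx: "((\<lambda>s. ?x s - x0) has_vector_derivative e m) (at s)" for s
      by (auto intro!: derivative_eq_intros)
    have dW1: "((\<lambda>s. 2 * (?A s \<bullet> B t1 (?x s) (e m))) has_real_derivative W2 m) (at 0)"
      using DERIV_cmult[OF has_real_derivative_inner[OF dA[of 0] dB[of 0]], where c = 2]
      by (simp add: W2_def power2_norm_eq_inner algebra_simps)
    have dV1: "((\<lambda>s. 2 * ((u t1 (?x s) - \<xi>) \<bullet> (?A s *v e m))) has_real_derivative V2 m) (at 0)"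
      using DERIV_cmult[OF has_real_derivative_inner[OF du[of 0] dAe[of 0]], where c = 2]
      by (simp add: V2_def power2_norm_eq_inner algebra_simps)
    have dZ: "((\<lambda>s. \<psi> t1 (?x s)) has_real_derivative - 2 * ((?x s - x0) \<bullet> e m)) (at s)" for s
      unfolding \<psi>_def
      using DERIV_diff[OF DERIV_diff[OF DERIV_const[of "r\<^sup>2"] has_real_derivative_norm_squared[OF dx[of s]]] DERIV_const[of "t1 - t0"]]
      by simp
    have dZ1: "((\<lambda>s. - 2 * ((?x s - x0) \<bullet> e m)) has_real_derivative - 2 * (norm (e m))\<^sup>2) (at 0)"
      using DERIV_cmult[OF has_real_derivative_inner[OF dx[of 0] has_vector_derivative_const[where c = "e m"]], where c = "-2"]
      by (simp add: power2_norm_eq_inner)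
    have "isCont (\<lambda>s. \<psi> t1 (?x s)) 0"
      using dZ DERIV_isCont by blast
    then have "((\<lambda>s. \<psi> t1 (?x s)) \<longlongrightarrow> \<psi> t1 (?x 0)) (nhds 0)"
      unfolding isCont_def
      by (rule iffD1[OF tendsto_at_iff_tendsto_nhds[where g = "\<lambda>s. \<psi> t1 (?x s)"]])
    then have "eventually (\<lambda>s. 0 < \<psi> t1 (?x s)) (nhds 0)"
      using pos1 by (intro order_tendstoD(1)[where y = "\<psi> t1 (?x 0)"]) auto
    then obtain d where d: "0 < d" "\<And>s. \<bar>s\<bar> < d \<Longrightarrow> 0 < \<psi> t1 (?x s)"
      by (auto simp: eventually_nhds_metric dist_real_def)
    have "W2 m / (norm (?A 0))\<^sup>2 + weight * V2 m + 2 * (- 2 * (norm (e m))\<^sup>2 / \<psi> t1 (?x 0))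
       \<le> 2 * weight\<^sup>2 * (2 * ((u t1 (?x 0) - \<xi>) \<bullet> (?A 0 *v e m)))\<^sup>2
         + 10 * ((- 2 * ((?x 0 - x0) \<bullet> e m)) / \<psi> t1 (?x 0))\<^sup>2"
    proof (rule log_product_second_derivative_test[OF has_real_derivative_norm_squared[OF dA] dW1
            has_real_derivative_norm_squared[OF du] dV1 dZ dZ1 _ _ d(1)])
      show "0 < (norm (?A 0))\<^sup>2" using a by auto
      show "0 < \<psi> t1 (?x 0)" using pos1 by simp
      show "(norm (?A s))\<^sup>2 * exp (weight * (norm (u t1 (?x s) - \<xi>))\<^sup>2) * (\<psi> t1 (?x s))\<^sup>2
        \<le> (norm (?A 0))\<^sup>2 * exp (weight * (norm (u t1 (?x 0) - \<xi>))\<^sup>2) * (\<psi> t1 (?x 0))\<^sup>2" if "\<bar>s\<bar> < d" for s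
        using max[of t1 "?x s"] d(2)[OF that] t1 unfolding \<Phi>_def by auto
    qed
    then have "W2 m / w + weight * V2 m - 4 * ((norm (e m))\<^sup>2 / p)
       \<le> 8 * weight\<^sup>2 * ((u t1 x1 - \<xi>) \<bullet> (Dx u t1 x1 *v e m))\<^sup>2 + 40 * ((x1 - x0) \<bullet> e m)\<^sup>2 / p\<^sup>2"
      by (simp add: w_def p_def power_mult_distrib power_divide)
    also have "\<dots> \<le> 8 * weight\<^sup>2 * (\<delta>\<^sup>2 * (w * C\<sigma>)) + 40 * (r\<^sup>2 * C\<sigma>) / p\<^sup>2"
    proof (intro add_mono mult_left_mono divide_right_mono)
      have e: "(norm (e m))\<^sup>2 \<le> C\<sigma>" using S_column_sq_le[OF t1'] by (simp add: e_def)
      have "((u t1 x1 - \<xi>) \<bullet> (Dx u t1 x1 *v e m))\<^sup>2 \<le> (norm (u t1 x1 - \<xi>))\<^sup>2 * (norm (Dx u t1 x1 *v e m))\<^sup>2"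
        by (simp add: power2_norm_eq_inner Cauchy_Schwarz_ineq)
      also have "\<dots> \<le> \<delta>\<^sup>2 * (w * C\<sigma>)"
      proof (rule mult_mono)
        show "(norm (u t1 x1 - \<xi>))\<^sup>2 \<le> \<delta>\<^sup>2" using \<delta>(1) by (simp add: power_mono)
        have "(norm (Dx u t1 x1 *v e m))\<^sup>2 \<le> (norm (Dx u t1 x1) * norm (e m))\<^sup>2"
          by (intro power_mono norm_matrix_vector_mult_le) auto
        also have "\<dots> \<le> w * C\<sigma>"
          unfolding power_mult_distrib w_def using e by (intro mult_left_mono) auto
        finally show "(norm (Dx u t1 x1 *v e m))\<^sup>2 \<le> w * C\<sigma>" .
      qed auto
      finally show "((u t1 x1 - \<xi>) \<bullet> (Dx u t1 x1 *v e m))\<^sup>2 \<le> \<delta>\<^sup>2 * (w * C\<sigma>)" .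
      have "((x1 - x0) \<bullet> e m)\<^sup>2 \<le> (norm (x1 - x0))\<^sup>2 * (norm (e m))\<^sup>2"
        by (simp add: power2_norm_eq_inner Cauchy_Schwarz_ineq)
      also have "\<dots> \<le> r\<^sup>2 * C\<sigma>" using xr e by (intro mult_mono) auto
      finally show "((x1 - x0) \<bullet> e m)\<^sup>2 \<le> r\<^sup>2 * C\<sigma>" .
    qed auto
    finally show ?thesis by (simp add: mult_ac)
  qed
  have "(\<Sum>m\<in>UNIV. W2 m / w + weight * V2 m - 4 * ((norm (e m))\<^sup>2 / p))
      \<le> (\<Sum>m\<in>(UNIV :: 'd set). 8 * weight\<^sup>2 * \<delta>\<^sup>2 * C\<sigma> * w + 40 * r\<^sup>2 * C\<sigma> / p\<^sup>2)"
    by (intro sum_mono space)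
  also have "\<dots> = 2 * (4 * weight\<^sup>2 * \<delta>\<^sup>2 * trace_bound) * w + 40 * r\<^sup>2 * trace_bound / p\<^sup>2"
    by (simp add: trace_bound_def algebra_simps)
  also have "\<dots> \<le> 2 * 1 * w + 40 * r\<^sup>2 * trace_bound / p\<^sup>2"
    using \<delta>(3) w1 by (intro add_mono mult_right_mono mult_left_mono order_refl) auto
  finally have space_sum: "(\<Sum>m\<in>UNIV. W2 m) / w + weight * (\<Sum>m\<in>UNIV. V2 m) - 4 * ((\<Sum>m\<in>UNIV. (norm (e m))\<^sup>2) / p)
      \<le> 2 * w + 40 * r\<^sup>2 * trace_bound / p\<^sup>2"
    by (simp add: sum.distrib sum_subtractf sum_distrib_left[symmetric] sum_divide_distrib[symmetric])
  \<comment> \<open>The point \<open>(s,x1)\<close> stays in the region \<open>\<psi> \<ge> 0\<close> until \<open>s = t1 + \<psi>(t1,x1)\<close>, so the maximum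
      property can be used to the right of \<open>t1\<close>.\<close>
  have time: "2 * (Dx u t1 x1 \<bullet> At t1 x1) / w + weight * (2 * ((u t1 x1 - \<xi>) \<bullet> ut t1 x1)) - 2 / p \<le> 0"
  proof -
    define E where "E = exp (weight * (norm (u t1 x1 - \<xi>))\<^sup>2)"
    have du: "((\<lambda>s. u s x1 - \<xi>) has_vector_derivative ut t1 x1) (at t1 within {0..<T})"
      using u_t[OF t1(1)] by (auto intro!: derivative_eq_intros)
    have dZ: "((\<lambda>s. \<psi> s x1) has_real_derivative - 1) (at t1 within {0..<T})"
      unfolding \<psi>_def by (auto intro!: derivative_eq_intros)
    have "((\<lambda>s. \<Phi> s x1) has_real_derivative
      (2 * (Dx u t1 x1 \<bullet> At t1 x1) * E + (E * (weight * (2 * ((u t1 x1 - \<xi>) \<bullet> ut t1 x1)))) * w) * p\<^sup>2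
        + (2 * p * - 1) * (w * E)) (at t1 within {0..<T})"
      unfolding \<Phi>_def w_def p_def E_def
      by (rule derivative_eq_intros has_real_derivative_norm_squared[OF Du_t[OF t1(1)]]
            has_real_derivative_norm_squared[OF du] dZ refl)+ simp
    then have "(2 * (Dx u t1 x1 \<bullet> At t1 x1) * E + (E * (weight * (2 * ((u t1 x1 - \<xi>) \<bullet> ut t1 x1)))) * w) * p\<^sup>2
        + (2 * p * - 1) * (w * E) \<le> 0"
    proof (rule right_derivative_nonpos_at_max[where d = p])
      show "\<Phi> s x1 \<le> \<Phi> t1 x1" if "t1 \<le> s" "s < T" "s < t1 + p" for s
        using that by (intro max) (auto simp: p_def \<psi>_def)
    qed (use t1 p in auto)
    also have "(2 * (Dx u t1 x1 \<bullet> At t1 x1) * E + (E * (weight * (2 * ((u t1 x1 - \<xi>) \<bullet> ut t1 x1)))) * w) * p\<^sup>2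
        + (2 * p * - 1) * (w * E) = (E * w * p\<^sup>2) *
        (2 * (Dx u t1 x1 \<bullet> At t1 x1) / w + weight * (2 * ((u t1 x1 - \<xi>) \<bullet> ut t1 x1)) - 2 / p)"
      using w1 p by (simp add: field_simps power2_eq_square)
    finally show ?thesis
      using w1 p by (simp add: mult_le_0_iff E_def)
  qed
  have "- gradient_loss * w * w \<le> (\<Sum>m\<in>UNIV. (norm (B t1 x1 (e m)))\<^sup>2) + 2 * (Dx u t1 x1 \<bullet> heat_Du t1 x1)"
    using gradient_energy_lower_bound[OF t1(1) a] by (simp add: e_def w_def power4_eq_xxxx power2_eq_square mult.assoc)
  also have "\<dots> = 2 * (Dx u t1 x1 \<bullet> At t1 x1) + 1 / 2 * (\<Sum>m\<in>UNIV. W2 m)"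
    by (simp add: W2_def heat_Du_def e_def sum.distrib sum_distrib_left[symmetric] inner_add_right inner_sum_right)
  finally have "- gradient_loss * w * w / w \<le> (2 * (Dx u t1 x1 \<bullet> At t1 x1) + 1 / 2 * (\<Sum>m\<in>UNIV. W2 m)) / w"
    using w1 by (intro divide_right_mono) auto
  then have grad: "- gradient_loss * w \<le> 2 * (Dx u t1 x1 \<bullet> At t1 x1) / w + 1 / 2 * ((\<Sum>m\<in>UNIV. W2 m) / w)"
    using w1 by (simp add: add_divide_distrib)
  have "w / (2 * C\<sigma>) \<le> 2 * ((u t1 x1 - \<xi>) \<bullet> ut t1 x1) + 1 / 2 * (\<Sum>m\<in>UNIV. V2 m)"
    using oscillation_energy_lower_bound[OF t1(1) a \<delta>(1,2)] by (simp add: V2_def e_def w_def)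
  then have "weight * (w / (2 * C\<sigma>)) \<le> weight * (2 * ((u t1 x1 - \<xi>) \<bullet> ut t1 x1) + 1 / 2 * (\<Sum>m\<in>UNIV. V2 m))"
    using weight_pos by (intro mult_left_mono) auto
  moreover have "weight * (w / (2 * C\<sigma>)) = (gradient_loss + 2) * w"
    using pos by (simp add: weight_def)
  ultimately have osc: "(gradient_loss + 2) * w \<le> weight * (2 * ((u t1 x1 - \<xi>) \<bullet> ut t1 x1)) + 1 / 2 * (weight * (\<Sum>m\<in>UNIV. V2 m))"
    by (simp add: algebra_simps)
  have "(\<Sum>m\<in>UNIV. (norm (e m))\<^sup>2) / p \<le> trace_bound / p"
    using sum_columns_sq_le[OF t1'] p by (intro divide_right_mono) (auto simp: e_def)
  moreover have "(gradient_loss + 2) * w = gradient_loss * w + 2 * w" "(2 + 2 * trace_bound) / p = 2 / p + 2 * (trace_bound / p)"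
      "40 * r\<^sup>2 * trace_bound / p\<^sup>2 = 2 * (20 * r\<^sup>2 * trace_bound / p\<^sup>2)"
    by (simp_all add: distrib_right add_divide_distrib)
  ultimately have "w \<le> (2 + 2 * trace_bound) / p + 20 * r\<^sup>2 * trace_bound / p\<^sup>2"
    using space_sum time grad osc by linarith
  then have "w * p\<^sup>2 \<le> ((2 + 2 * trace_bound) / p + 20 * r\<^sup>2 * trace_bound / p\<^sup>2) * p\<^sup>2"
    by (intro mult_right_mono) auto
  also have "\<dots> = (2 + 2 * trace_bound) * p + 20 * r\<^sup>2 * trace_bound"
    using p by (simp add: field_simps power2_eq_square)
  also have "\<dots> \<le> (2 + 2 * trace_bound) * r\<^sup>2 + 20 * r\<^sup>2 * trace_bound"
    using pr trace_bound_pos by (intro add_right_mono mult_left_mono) auto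
  finally show ?thesis by (simp add: w_def p_def algebra_simps)
qed

text \<open>
  At the centre \<open>\<psi> = r\<^sup>2\<close> and the weight is \<open>1\<close>, so the maximum of \<open>\<Phi>\<close> dominates \<open>r\<^sup>4 |Du(t0,x0)|\<^sup>2\<close>.
  The maximum itself is controlled because it lies where \<open>\<psi> = 0\<close>, at the terminal time, where
  \<open>|Du| < 1\<close>, or where \<open>interior_maximum_bound\<close> applies.
\<close>
lemma local_gradient_bound:
  assumes t0: "t0 \<in> {0..T}" and r: "0 < r"
    and osc: "\<And>t x. t \<in> {t0..T} \<Longrightarrow> t - t0 \<le> r\<^sup>2 \<Longrightarrow> norm (x - x0) \<le> r \<Longrightarrow> norm (u t x - u t0 x0) \<le> \<delta>"
    and \<delta>: "32 * real CARD('n) * Cf * \<delta> * C\<sigma> \<le> 1" "4 * weight\<^sup>2 * \<delta>\<^sup>2 * trace_bound \<le> 1"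
    and terminal: "\<And>x. norm (Dx u T x) \<le> G"
  shows "(norm (Dx u t0 x0))\<^sup>2 \<le> exp (weight * \<delta>\<^sup>2) * (1 + G\<^sup>2 + (2 + 22 * trace_bound) / r\<^sup>2)"
proof -
  define \<psi> where "\<psi> = (\<lambda>t x. r\<^sup>2 - (norm (x - x0))\<^sup>2 - (t - t0))"
  define \<Phi> where "\<Phi> = (\<lambda>t x. (norm (Dx u t x))\<^sup>2 * exp (weight * (norm (u t x - u t0 x0))\<^sup>2) * (\<psi> t x)\<^sup>2)"
  define Q where "Q = ({t0..T} \<times> cball x0 r) \<inter> {(t, x). 0 \<le> \<psi> t x}"
  have mem: "(t, x) \<in> Q \<longleftrightarrow> t \<in> {t0..T} \<and> 0 \<le> \<psi> t x" for t x
  proof -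
    have "norm (x - x0) \<le> r" if "t0 \<le> t" "0 \<le> \<psi> t x"
    proof -
      have "(norm (x - x0))\<^sup>2 \<le> r\<^sup>2" using that unfolding \<psi>_def by linarith
      then show ?thesis using r power2_le_imp_le by force
    qed
    then show ?thesis by (auto simp: Q_def dist_norm norm_minus_commute)
  qed
  have "continuous_on UNIV (\<lambda>z. \<psi> (fst z) (snd z))"
    unfolding \<psi>_def by (intro continuous_intros)
  then have "closed {z. 0 \<le> \<psi> (fst z) (snd z)}"
    by (intro closed_Collect_le continuous_on_const)
  then have "compact Q"
    unfolding Q_def case_prod_unfold by (intro compact_Int_closed compact_Times) auto
  moreover have "(t0, x0) \<in> Q"
    using t0 r by (simp add: mem \<psi>_def)
  moreover have "continuous_on Q (\<lambda>(t, x). \<Phi> t x)"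
  proof -
    have sub: "Q \<subseteq> {0..T} \<times> UNIV" using t0 by (auto simp: Q_def)
    show ?thesis
      unfolding \<Phi>_def \<psi>_def case_prod_unfold
      by (intro continuous_intros continuous_on_subset[OF Du_cont[unfolded case_prod_unfold] sub]
          continuous_on_subset[OF u_cont[unfolded case_prod_unfold] sub])
  qed
  ultimately obtain t1 x1 where m: "(t1, x1) \<in> Q" "\<And>t x. (t, x) \<in> Q \<Longrightarrow> \<Phi> t x \<le> \<Phi> t1 x1"
    using continuous_attains_sup[of Q "\<lambda>(t, x). \<Phi> t x"] by fastforce
  define w where "w = (norm (Dx u t1 x1))\<^sup>2"
  define p where "p = \<psi> t1 x1"
  have t1: "t1 \<in> {t0..T}" and p0: "0 \<le> p" using m(1) by (auto simp: mem p_def)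
  then have "t0 \<le> t1" by simp
  with p0 zero_le_power2[of "norm (x1 - x0)"]
  have p: "0 \<le> p" "p \<le> r\<^sup>2" and "(norm (x1 - x0))\<^sup>2 \<le> r\<^sup>2" "t1 - t0 \<le> r\<^sup>2"
    unfolding p_def \<psi>_def by linarith+
  then have v: "norm (u t1 x1 - u t0 x0) \<le> \<delta>"
    using r power2_le_imp_le[of "norm (x1 - x0)" r] by (intro osc t1) auto
  have p4: "p\<^sup>2 \<le> r ^ 4"
    using power_mono[OF p(2,1), of 2] by (simp add: power_mult[symmetric])
  \<comment> \<open>The three summands correspond to \<open>w < 1\<close>, a maximum at the terminal time, and a maximum before it.\<close>
  have wp: "w * p\<^sup>2 \<le> r ^ 4 * (1 + G\<^sup>2 + (2 + 22 * trace_bound) / r\<^sup>2)"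
  proof -
    have r4: "r ^ 4 * (1 + G\<^sup>2 + (2 + 22 * trace_bound) / r\<^sup>2) = r ^ 4 + r ^ 4 * G\<^sup>2 + (2 + 22 * trace_bound) * r\<^sup>2"
      using r by (simp add: field_simps power4_eq_xxxx power2_eq_square)
    have nn: "0 \<le> r ^ 4" "0 \<le> r ^ 4 * G\<^sup>2" "0 \<le> (2 + 22 * trace_bound) * r\<^sup>2"
      using trace_bound_pos by auto
    consider "w < 1" | "t1 = T" | "p = 0" | "1 \<le> w" "t1 < T" "0 < p"
      using t1 p by force
    then show ?thesis
    proof cases
      case 1
      then have "w * p\<^sup>2 \<le> 1 * r ^ 4" using p4 by (intro mult_mono) auto
      then show ?thesis unfolding r4 using nn by linarith
    next
      case 2
      then have "w \<le> G\<^sup>2" using terminal[of x1] by (simp add: w_def power_mono)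
      then have "w * p\<^sup>2 \<le> G\<^sup>2 * r ^ 4" using p4 by (intro mult_mono) auto
      then show ?thesis unfolding r4 using nn by (simp only: mult.commute[of "G\<^sup>2"])
    next
      case 3
      then show ?thesis unfolding r4 using nn by simp
    next
      case 4
      have "(norm (Dx u t1 x1))\<^sup>2 * (\<psi> t1 x1)\<^sup>2 \<le> (2 + 22 * trace_bound) * r\<^sup>2"
        unfolding \<psi>_def
      proof (rule interior_maximum_bound[OF _ _ _ v \<delta>])
        show "t1 \<in> {0..<T}" "t0 \<le> t1" using 4 t1 t0 by auto
        show "0 < r\<^sup>2 - (norm (x1 - x0))\<^sup>2 - (t1 - t0)" using 4 by (simp add: p_def \<psi>_def)
        have "1\<^sup>2 \<le> (norm (Dx u t1 x1))\<^sup>2" using 4 by (simp add: w_def)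
        then show "1 \<le> norm (Dx u t1 x1)" by (rule power2_le_imp_le) simp
        show "(norm (Dx u t x))\<^sup>2 * exp (weight * (norm (u t x - u t0 x0))\<^sup>2) * (r\<^sup>2 - (norm (x - x0))\<^sup>2 - (t - t0))\<^sup>2
          \<le> (norm (Dx u t1 x1))\<^sup>2 * exp (weight * (norm (u t1 x1 - u t0 x0))\<^sup>2) * (r\<^sup>2 - (norm (x1 - x0))\<^sup>2 - (t1 - t0))\<^sup>2"
          if "t \<in> {t1..T}" "0 \<le> r\<^sup>2 - (norm (x - x0))\<^sup>2 - (t - t0)" for t x
          using m(2)[of t x] that t1 by (simp add: mem \<Phi>_def \<psi>_def)
      qed
      then show ?thesis unfolding r4 w_def p_def using nn by linarith
    qed
  qed
  have "(norm (Dx u t0 x0))\<^sup>2 * r ^ 4 = \<Phi> t0 x0"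
    by (simp add: \<Phi>_def \<psi>_def power_mult[symmetric])
  also have "\<dots> \<le> \<Phi> t1 x1"
    using m(2) \<open>(t0, x0) \<in> Q\<close> by blast
  also have "\<dots> = exp (weight * (norm (u t1 x1 - u t0 x0))\<^sup>2) * (w * p\<^sup>2)"
    by (simp add: \<Phi>_def w_def p_def)
  also have "\<dots> \<le> exp (weight * \<delta>\<^sup>2) * (r ^ 4 * (1 + G\<^sup>2 + (2 + 22 * trace_bound) / r\<^sup>2))"
  proof (rule mult_mono[OF _ wp])
    show "exp (weight * (norm (u t1 x1 - u t0 x0))\<^sup>2) \<le> exp (weight * \<delta>\<^sup>2)"
      using weight_pos v by (simp add: power_mono)
  qed (auto simp: w_def)
  finally have "(norm (Dx u t0 x0))\<^sup>2 * r ^ 4 \<le> (exp (weight * \<delta>\<^sup>2) * (1 + G\<^sup>2 + (2 + 22 * trace_bound) / r\<^sup>2)) * r ^ 4"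
    by (simp add: mult_ac)
  then show ?thesis
    using r by simp
qed

section \<open>A priori finiteness of the Hoelder norm\<close>

lemma space_lipschitz:
  assumes t: "t \<in> {0..T}" and \<Lambda>: "\<And>x. norm (Dx u t x) \<le> \<Lambda>"
  shows "norm (u t x - u t y) \<le> \<Lambda> * norm (x - y)"
proof (rule differentiable_bound[of UNIV "u t" "\<lambda>x. (*v) (Dx u t x)"])
  show "onorm ((*v) (Dx u t x)) \<le> \<Lambda>" for x
  proof (rule onorm_bound)
    show "norm (Dx u t x *v z) \<le> \<Lambda> * norm z" for z
      using norm_matrix_vector_mult_le[of "Dx u t x" z] \<Lambda>[of x]
      by (meson mult_right_mono norm_ge_zero order_trans)
    show "0 \<le> \<Lambda>" using \<Lambda> norm_ge_zero order_trans by blast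
  qed
qed (use u_x[OF t] has_derivative_at_withinI in auto)

text \<open>
  Comparison of \<open>\<eta> \<bullet> (u - u(t0,x0))\<close> with \<open>\<Lambda> (\<delta> + |x - x0|\<^sup>2/\<delta>) + N (t0 - t)\<close>. This dominates at time
  \<open>t0\<close> because \<open>u(t0,\<cdot>)\<close> is \<open>\<Lambda>\<close>-Lipschitz and \<open>|z| \<le> \<delta> + |z|\<^sup>2/\<delta>\<close>, and dominates for large \<open>|x - x0|\<close> because \<open>u\<close> is bounded; the slope \<open>N\<close> is
  just too large for an interior maximum of the difference. Taking \<open>\<delta> = sqrt (t0 - s)\<close> gives
  the exponent \<open>1/2\<close> in time.
\<close>
lemma barrier_estimate:
  fixes \<eta> :: "real^'n::{finite,linorder}"
  assumes st: "s \<in> {0..T}" "t0 \<in> {0..T}" "s \<le> t0" and \<eta>: "norm \<eta> \<le> 1" and \<delta>: "0 < \<delta>"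
    and U: "\<And>t x. t \<in> {0..T} \<Longrightarrow> norm (u t x) \<le> U"
    and \<Lambda>: "\<And>t x. t \<in> {0..T} \<Longrightarrow> norm (Dx u t x) \<le> \<Lambda>" "0 < \<Lambda>"
    and FB: "\<And>t x. t \<in> {0..T} \<Longrightarrow> norm (F t x) \<le> FB"
  shows "\<eta> \<bullet> (u s x0 - u t0 x0) \<le> \<Lambda> * \<delta> + (FB + 1 + \<Lambda> * trace_bound / \<delta>) * (t0 - s)"
proof (rule ccontr)
  assume neg: "\<not> ?thesis"
  define N where "N = FB + 1 + \<Lambda> * trace_bound / \<delta>"
  define \<phi> where "\<phi> = (\<lambda>t x. \<eta> \<bullet> (u t x - u t0 x0) - \<Lambda> * (\<delta> + (norm (x - x0))\<^sup>2 / \<delta>) - N * (t0 - t))"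
  have FB0: "0 \<le> FB" using FB[OF st(2), of x0] norm_ge_zero order_trans by blast
  have N: "0 \<le> N" using FB0 \<Lambda>(2) \<delta> trace_bound_pos by (simp add: N_def)
  have start: "0 < \<phi> s x0" using neg by (simp add: \<phi>_def N_def)
  \<comment> \<open>Outside the ball of this radius the barrier exceeds the oscillation \<open>2 U\<close> of \<open>u\<close>.\<close>
  define \<rho> where "\<rho> = sqrt (2 * U * \<delta> / \<Lambda> + 1)"
  have U0: "0 \<le> U" using U[OF st(2), of x0] norm_ge_zero order_trans by blast
  have \<rho>: "0 \<le> \<rho>" "\<rho>\<^sup>2 = 2 * U * \<delta> / \<Lambda> + 1"
    using U0 \<delta> \<Lambda>(2) by (simp_all add: \<rho>_def)
  have eta_le: "\<eta> \<bullet> z \<le> norm z" for z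
    using norm_cauchy_schwarz[of \<eta> z] mult_right_mono[OF \<eta> norm_ge_zero[of z]] by simp
  let ?Q = "{s..t0} \<times> cball x0 \<rho>"
  have sub: "?Q \<subseteq> {0..T} \<times> UNIV" using st by auto
  have "compact ?Q" by (intro compact_Times) auto
  moreover have sQ: "(s, x0) \<in> ?Q" using st \<rho> by auto
  moreover have "continuous_on ?Q (\<lambda>(t, x). \<phi> t x)"
    unfolding \<phi>_def case_prod_unfold
    by (intro continuous_intros continuous_on_subset[OF u_cont[unfolded case_prod_unfold] sub]) (use \<delta> in auto)
  ultimately obtain t1 x1 where m: "(t1, x1) \<in> ?Q" "\<And>t x. (t, x) \<in> ?Q \<Longrightarrow> \<phi> t x \<le> \<phi> t1 x1"
    using continuous_attains_sup[of ?Q "\<lambda>(t, x). \<phi> t x"] by fastforce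
  have pos1: "0 < \<phi> t1 x1" using m(2)[OF sQ] start by linarith
  have t1: "s \<le> t1" "t1 \<le> t0" "t1 \<in> {0..T}" using m(1) st by auto
  have "t1 \<noteq> t0"
  proof
    assume "t1 = t0"
    have 1: "\<eta> \<bullet> (u t0 x1 - u t0 x0) \<le> \<Lambda> * norm (x1 - x0)"
      using eta_le[of "u t0 x1 - u t0 x0"] space_lipschitz[OF st(2) \<Lambda>(1)[OF st(2)], of x1 x0] by linarith
    have "norm (x1 - x0) \<le> \<delta> + (norm (x1 - x0))\<^sup>2 / \<delta>"
    proof -
      have "norm (x1 - x0) * \<delta> \<le> \<delta>\<^sup>2 + (norm (x1 - x0))\<^sup>2"
        using sum_squares_bound[of "norm (x1 - x0)" \<delta>]
          mult_nonneg_nonneg[OF norm_ge_zero[of "x1 - x0"] less_imp_le[OF \<delta>]] by linarith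
      then show ?thesis using \<delta> by (simp add: field_simps power2_eq_square)
    qed
    then have "\<Lambda> * norm (x1 - x0) \<le> \<Lambda> * (\<delta> + (norm (x1 - x0))\<^sup>2 / \<delta>)"
      using \<Lambda>(2) by (intro mult_left_mono) auto
    with 1 show False
      using pos1 \<open>t1 = t0\<close> by (simp add: \<phi>_def)
  qed
  then have t1T: "t1 \<in> {0..<T}" using t1 st by auto
  have inner: "norm (x1 - x0) < \<rho>"
  proof (rule ccontr)
    assume "\<not> norm (x1 - x0) < \<rho>"
    then have "\<rho>\<^sup>2 \<le> (norm (x1 - x0))\<^sup>2" using \<rho> by (intro power_mono) auto
    then have "2 * U * \<delta> / \<Lambda> \<le> (norm (x1 - x0))\<^sup>2" using \<rho> by linarith
    then have "2 * U \<le> \<Lambda> * ((norm (x1 - x0))\<^sup>2 / \<delta>)"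
      using \<Lambda>(2) \<delta> by (simp add: field_simps)
    moreover have "\<eta> \<bullet> (u t1 x1 - u t0 x0) \<le> U + U"
      using eta_le[of "u t1 x1 - u t0 x0"] norm_triangle_ineq4[of "u t1 x1" "u t0 x0"]
        U[OF t1(3), of x1] U[OF st(2), of x0] by linarith
    moreover have "0 \<le> N * (t0 - t1)" "0 \<le> \<Lambda> * \<delta>" using N t1 \<Lambda>(2) \<delta> by auto
    ultimately show False using pos1 by (simp add: \<phi>_def distrib_left)
  qed
  have time: "\<eta> \<bullet> ut t1 x1 + N \<le> 0"
  proof (rule right_derivative_nonpos_at_max[where h = "\<lambda>t. \<phi> t x1" and t = t1 and T = T and d = "t0 - t1"])
    have "((\<lambda>t. \<eta> \<bullet> (u t x1 - u t0 x0)) has_real_derivative \<eta> \<bullet> ut t1 x1) (at t1 within {0..<T})"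
      using u_t[OF t1T, of x1]
      unfolding has_real_derivative_iff_has_vector_derivative
      by (auto intro!: derivative_eq_intros bounded_linear.has_vector_derivative[OF bounded_linear_inner_right])
    then show "((\<lambda>t. \<phi> t x1) has_real_derivative \<eta> \<bullet> ut t1 x1 + N) (at t1 within {0..<T})"
      unfolding \<phi>_def by (auto intro!: derivative_eq_intros)
    show "\<phi> t x1 \<le> \<phi> t1 x1" if "t1 \<le> t" "t < T" "t < t1 + (t0 - t1)" for t
      using that m(1) t1 by (intro m(2)) auto
  qed (use t1T \<open>t1 \<noteq> t0\<close> t1 in auto)
  define e where "e m = S t1 x1 *v axis m 1" for m
  have "\<eta> \<bullet> (B t1 x1 (e m) *v e m) - 2 * \<Lambda> / \<delta> * (norm (e m))\<^sup>2 \<le> 0" for m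
  proof -
    let ?x = "\<lambda>r. x1 + r *\<^sub>R e m"
    have du: "((\<lambda>r. u t1 (?x r) - u t0 x0) has_vector_derivative Dx u t1 (?x r) *v e m) (at r)" for r
      using has_vector_derivative_along_line[OF u_x[OF t1(3)]]
      by (auto intro!: derivative_eq_intros)
    have dA: "((\<lambda>r. Dx u t1 (?x r) *v e m) has_vector_derivative B t1 (?x r) (e m) *v e m) (at r)" for r
      by (rule bounded_linear.has_vector_derivative[OF
          bounded_bilinear.bounded_linear_left[OF bounded_bilinear_matrix_vector]
          has_vector_derivative_along_line[OF Du_x[OF t1(3)]]])
    have dx: "((\<lambda>r. ?x r - x0) has_vector_derivative e m) (at r)" for r
      by (auto intro!: derivative_eq_intros)
    note c = has_vector_derivative_const[where c = \<eta>]
    have 1: "((\<lambda>r. \<phi> t1 (?x r)) has_real_derivative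
        \<eta> \<bullet> (Dx u t1 (?x r) *v e m) - 2 * \<Lambda> / \<delta> * ((?x r - x0) \<bullet> e m)) (at r)" for r
      unfolding \<phi>_def
      using DERIV_diff[OF DERIV_diff[OF has_real_derivative_inner[OF c du[of r]]
          DERIV_cmult[OF DERIV_add[OF DERIV_const[of \<delta>]
            DERIV_cdivide[OF has_real_derivative_norm_squared[OF dx[of r]], where c = \<delta>]], where c = \<Lambda>]]
          DERIV_const[of "N * (t0 - t1)"]]
      by (simp add: mult_ac)
    have 2: "((\<lambda>r. \<eta> \<bullet> (Dx u t1 (?x r) *v e m) - 2 * \<Lambda> / \<delta> * ((?x r - x0) \<bullet> e m)) has_real_derivative
        \<eta> \<bullet> (B t1 x1 (e m) *v e m) - 2 * \<Lambda> / \<delta> * (norm (e m))\<^sup>2) (at 0)"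
      using DERIV_diff[OF has_real_derivative_inner[OF c dA[of 0]]
          DERIV_cmult[OF has_real_derivative_inner[OF dx[of 0] has_vector_derivative_const[where c = "e m"]], where c = "2 * \<Lambda> / \<delta>"]]
      by (simp add: power2_norm_eq_inner)
    have "isCont (\<lambda>r. norm (?x r - x0)) 0"
      by (intro continuous_intros)
    then have "((\<lambda>r. norm (?x r - x0)) \<longlongrightarrow> norm (?x 0 - x0)) (nhds 0)"
      unfolding isCont_def
      by (rule iffD1[OF tendsto_at_iff_tendsto_nhds[where g = "\<lambda>r. norm (?x r - x0)"]])
    then have "eventually (\<lambda>r. norm (?x r - x0) < \<rho>) (nhds 0)"
      using inner by (intro order_tendstoD(2)[where y = "norm (?x 0 - x0)"]) auto
    then obtain d where d: "0 < d" "\<And>r. \<bar>r\<bar> < d \<Longrightarrow> norm (?x r - x0) < \<rho>"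
      by (auto simp: eventually_nhds_metric dist_real_def)
    show ?thesis
    proof (rule derivative_tests_at_local_max(2)[OF d(1) 1 2])
      show "\<phi> t1 (?x r) \<le> \<phi> t1 (?x 0)" if "\<bar>r\<bar> < d" for r
        using m(2)[of t1 "?x r"] d(2)[OF that] m(1) by (simp add: dist_norm norm_minus_commute)
    qed
  qed
  then have "(\<Sum>m\<in>UNIV. \<eta> \<bullet> (B t1 x1 (e m) *v e m) - 2 * \<Lambda> / \<delta> * (norm (e m))\<^sup>2) \<le> 0"
    by (intro sum_nonpos) auto
  then have "(\<Sum>m\<in>UNIV. \<eta> \<bullet> (B t1 x1 (e m) *v e m)) \<le> 2 * \<Lambda> / \<delta> * (\<Sum>m\<in>UNIV. (norm (e m))\<^sup>2)"
    by (simp add: sum_subtractf sum_distrib_left)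
  also have "\<dots> \<le> 2 * \<Lambda> / \<delta> * trace_bound"
    using sum_columns_sq_le[OF t1(3), of x1] \<Lambda>(2) \<delta> by (intro mult_left_mono) (auto simp: e_def)
  finally have space: "(1 / 2) * (\<Sum>m\<in>UNIV. \<eta> \<bullet> (B t1 x1 (e m) *v e m)) \<le> \<Lambda> * trace_bound / \<delta>"
    by (simp add: mult_ac)
  have "\<eta> \<bullet> ut t1 x1 + (1 / 2) * (\<Sum>m\<in>UNIV. \<eta> \<bullet> (B t1 x1 (e m) *v e m)) + \<eta> \<bullet> F t1 x1 = 0"
    using arg_cong[OF pde[OF t1T, of x1], of "inner \<eta>"]
    by (simp add: inner_add_right inner_sum_right e_def S_def F_def)
  then show False
    using time space eta_le[of "F t1 x1"] FB[OF t1(3), of x1] unfolding N_def by linarith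
qed

text \<open>
  For nearby points, the exponent \<open>1/2\<close> in time from the barrier and the Lipschitz bound in space
  are better than \<open>\<alpha>/2\<close> and \<open>\<alpha>\<close>; for points at distance more than \<open>1\<close> in time or space the bound on \<open>u\<close>
  suffices.
\<close>
lemma holder_norm_finite:
  assumes \<alpha>: "0 < \<alpha>" "\<alpha> < 1"
  shows "holder_norm T \<alpha> u < \<infinity>"
proof -
  obtain U where U: "\<And>t x. t \<in> {0..T} \<Longrightarrow> norm (u t x) \<le> U"
    using u_bounded unfolding bounded_iff by fastforce
  obtain \<Lambda>0 where "\<And>t x. t \<in> {0..T} \<Longrightarrow> norm (Dx u t x) \<le> \<Lambda>0"
    using Du_bounded unfolding bounded_iff by fastforce
  then obtain \<Lambda> where \<Lambda>: "\<And>t x. t \<in> {0..T} \<Longrightarrow> norm (Dx u t x) \<le> \<Lambda>" "0 < \<Lambda>"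
    by (metis less_eq_real_def max.strict_coboundedI2 max.coboundedI1 zero_less_one)
  have U0: "0 \<le> U"
    using U[of 0 0] T_pos norm_ge_zero[of "u 0 0"] by (simp add: order_trans[OF norm_ge_zero])
  define FB where "FB = 4 * real CARD('n) * Cf * (1 + \<Lambda>\<^sup>2)"
  have FB: "norm (F t x) \<le> FB" if "t \<in> {0..T}" for t x
  proof -
    have "(norm (Dx u t x))\<^sup>2 \<le> \<Lambda>\<^sup>2" using \<Lambda>(1)[OF that] by (simp add: power_mono)
    then show ?thesis
      using F_le[OF that, of x] pos unfolding FB_def
      by (elim order_trans) (intro mult_left_mono, auto)
  qed
  have FB0: "0 \<le> FB" using pos by (simp add: FB_def)
  define H where "H = \<Lambda> + (FB + 1) + \<Lambda> * trace_bound"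
  have H0: "0 \<le> H" using \<Lambda>(2) FB0 trace_bound_pos by (simp add: H_def)
  have time: "norm (u s x - u t x) \<le> H * sqrt (t - s)" if st: "s \<in> {0..T}" "t \<in> {0..T}" "s < t" "t - s \<le> 1" for s t x
  proof -
    define \<theta> where "\<theta> = sqrt (t - s)"
    have \<theta>: "0 < \<theta>" "t - s = \<theta>\<^sup>2" "\<theta> \<le> 1" using st by (auto simp: \<theta>_def)
    have "norm (u s x - u t x) = sgn (u s x - u t x) \<bullet> (u s x - u t x)"
      by (cases "u s x = u t x")
        (simp_all add: sgn_div_norm power2_norm_eq_inner[symmetric] power2_eq_square)
    also have "\<dots> \<le> \<Lambda> * \<theta> + (FB + 1 + \<Lambda> * trace_bound / \<theta>) * (t - s)"
      using st \<theta> by (intro barrier_estimate[OF _ _ _ _ _ U \<Lambda> FB]) (auto simp: norm_sgn)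
    also have "\<dots> = \<Lambda> * \<theta> + (FB + 1) * (\<theta> * \<theta>) + \<Lambda> * trace_bound * \<theta>"
      using \<theta> by (simp add: field_simps power2_eq_square)
    also have "\<dots> \<le> \<Lambda> * \<theta> + (FB + 1) * (\<theta> * 1) + \<Lambda> * trace_bound * \<theta>"
      using \<theta> FB0 by (intro add_mono mult_left_mono order_refl) auto
    finally show ?thesis by (simp add: H_def \<theta>_def algebra_simps)
  qed
  have time': "norm (u s x - u t x) \<le> H * sqrt \<bar>t - s\<bar>" if "s \<in> {0..T}" "t \<in> {0..T}" "\<bar>t - s\<bar> \<le> 1" for s t x
    using time[of s t x] time[of t s x] that
    by (cases s t rule: linorder_cases) (auto simp: norm_minus_commute abs_minus_commute)
  define M where "M = 2 * U + H + \<Lambda>"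
  have quot: "norm (u t x - u t' x') / (\<bar>t - t'\<bar> powr (\<alpha> / 2) + norm (x - x') powr \<alpha>) \<le> M"
    if tt: "t \<in> {0..T}" "t' \<in> {0..T}" "t \<noteq> t'" "x \<noteq> x'" for t t' x x'
  proof -
    define P where "P = \<bar>t - t'\<bar> powr (\<alpha> / 2)"
    define Y where "Y = norm (x - x') powr \<alpha>"
    have PY: "0 < P" "0 < Y" using tt by (auto simp: P_def Y_def)
    have "norm (u t x - u t' x') \<le> M * (P + Y)"
    proof (cases "\<bar>t - t'\<bar> \<le> 1 \<and> norm (x - x') \<le> 1")
      case True
      have "sqrt \<bar>t - t'\<bar> = \<bar>t - t'\<bar> powr (1 / 2)"
        by (simp add: powr_half_sqrt)
      also have "\<dots> \<le> P"
        unfolding P_def using True \<alpha> by (intro powr_mono') auto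
      finally have 1: "sqrt \<bar>t' - t\<bar> \<le> P" by (simp add: abs_minus_commute)
      have "norm (x - x') = norm (x - x') powr 1" by simp
      also have "\<dots> \<le> Y"
        unfolding Y_def using True \<alpha> by (intro powr_mono') auto
      finally have 2: "norm (x - x') \<le> Y" .
      have "norm (u t x - u t' x') \<le> norm (u t x - u t' x) + norm (u t' x - u t' x')"
        using norm_triangle_ineq[of "u t x - u t' x" "u t' x - u t' x'"] by simp
      also have "\<dots> \<le> H * sqrt \<bar>t' - t\<bar> + \<Lambda> * norm (x - x')"
        using True tt by (intro add_mono time' space_lipschitz \<Lambda>) (auto simp: abs_minus_commute)
      also have "\<dots> \<le> H * P + \<Lambda> * Y"
        using 1 2 H0 \<Lambda>(2) by (intro add_mono mult_left_mono) auto
      also have "\<dots> \<le> M * P + M * Y"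
        using PY U0 H0 \<Lambda>(2) by (intro add_mono mult_right_mono) (auto simp: M_def)
      finally show ?thesis by (simp add: distrib_left)
    next
      case False
      have "1 \<le> P + Y"
      proof (cases "\<bar>t - t'\<bar> \<le> 1")
        case True
        then have "1 \<le> Y" unfolding Y_def using False \<alpha> by (intro ge_one_powr_ge_zero) auto
        then show ?thesis using PY by simp
      next
        case False
        then have "1 \<le> P" unfolding P_def using \<alpha> by (intro ge_one_powr_ge_zero) auto
        then show ?thesis using PY by simp
      qed
      moreover have "norm (u t x - u t' x') \<le> 2 * U"
        using norm_triangle_ineq4[of "u t x" "u t' x'"] U[OF tt(1), of x] U[OF tt(2), of x'] by simp
      moreover have "2 * U \<le> M" "0 \<le> M" using H0 \<Lambda>(2) U0 by (auto simp: M_def)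
      ultimately show ?thesis
        using mult_mono[of "2 * U" M 1 "P + Y"] U0 by simp
    qed
    then show ?thesis
      using PY by (simp add: P_def[symmetric] Y_def[symmetric] divide_le_eq)
  qed
  have "holder_norm T \<alpha> u \<le> ereal U + ereal M"
    unfolding holder_norm_def Linf_norm_def
    by (intro add_mono SUP_least) (auto intro!: U quot)
  also have "\<dots> < \<infinity>" by simp
  finally show ?thesis .
qed

end

section \<open>Small oscillation from the Hoelder norm\<close>

lemma exists_other_time:
  fixes t t' T \<rho> :: real
  assumes "t \<in> {0..T}" "t' \<in> {0..T}" "0 < T" "0 < \<rho>" "\<bar>t - t'\<bar> \<le> \<rho>"
  obtains s where "s \<in> {0..T}" "s \<noteq> t" "s \<noteq> t'" "\<bar>t - s\<bar> \<le> \<rho>" "\<bar>s - t'\<bar> \<le> \<rho>"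
proof (cases "t = t'")
  case True
  show ?thesis
  proof (cases "t < T")
    case True
    show ?thesis
      by (rule that[of "min (t + \<rho>) T"]) (use assms True \<open>t = t'\<close> in \<open>auto simp: min_def\<close>)
  next
    case False
    show ?thesis
      by (rule that[of "max (t - \<rho>) 0"]) (use assms False \<open>t = t'\<close> in \<open>auto simp: max_def\<close>)
  qed
next
  case False
  show ?thesis
  proof (rule that[of "(t + t') / 2"])
    have mid: "t - (t + t') / 2 = (t - t') / 2" "(t + t') / 2 - t' = (t - t') / 2"
      by (simp_all add: field_simps)
    show "\<bar>t - (t + t') / 2\<bar> \<le> \<rho>" "\<bar>(t + t') / 2 - t'\<bar> \<le> \<rho>"
      unfolding mid abs_divide using assms(4,5) by simp_all
  qed (use assms False in auto)
qed

lemma exists_other_point: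
  fixes x x' :: "'a::euclidean_space"
  assumes "0 < \<rho>" "norm (x - x') \<le> \<rho>"
  obtains y where "y \<noteq> x" "y \<noteq> x'" "norm (x - y) \<le> \<rho>" "norm (y - x') \<le> \<rho>"
proof (cases "x = x'")
  case True
  obtain b :: 'a where "b \<in> Basis" using nonempty_Basis by blast
  then show ?thesis
    using that[of "x + \<rho> *\<^sub>R b"] True assms nonzero_Basis[of b] by auto
next
  case False
  define y where "y = x + (1 / 2) *\<^sub>R (x' - x)"
  have 1: "x - y = (1 / 2) *\<^sub>R (x - x')" "y - x' = (1 / 2) *\<^sub>R (x - x')"
    by (simp_all add: y_def algebra_simps flip: scaleR_add_left)
  show ?thesis
  proof (rule that[of y])
    show "y \<noteq> x" "y \<noteq> x'" using 1 False by (metis eq_iff_diff_eq_0 scaleR_eq_0_iff zero_neq_one divide_eq_0_iff zero_neq_numeral)+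
    show "norm (x - y) \<le> \<rho>" "norm (y - x') \<le> \<rho>" unfolding 1 using assms norm_ge_zero[of "x - x'"] by simp_all
  qed
qed

text \<open>
  The supremum in the Hoelder seminorm runs over pairs of points that differ in both time and space.
  Passing through an intermediate point that differs from both ends in time and in space
  removes this restriction at the price of a factor \<open>2\<close>.
\<close>
lemma holder_norm_imp_oscillation_le:
  fixes v :: "real \<Rightarrow> 'a::euclidean_space \<Rightarrow> 'b::real_normed_vector"
  assumes T: "0 < T" and fin: "holder_norm T \<alpha> v < \<infinity>" and \<alpha>: "0 < \<alpha>"
    and t: "t \<in> {0..T}" "t' \<in> {0..T}" and r: "0 < r" "\<bar>t - t'\<bar> \<le> r\<^sup>2" "norm (x - x') \<le> r"
  shows "0 \<le> real_of_ereal (holder_norm T \<alpha> v)"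
    and "norm (v t x - v t' x') \<le> 4 * real_of_ereal (holder_norm T \<alpha> v) * r powr \<alpha>"
proof -
  define I where "I = {(t, x, t', x' :: 'a). t \<in> {0..T} \<and> t' \<in> {0..T} \<and> t \<noteq> t' \<and> x \<noteq> x'}"
  define Q where "Q = (\<lambda>(t, x, t', x'). ereal (norm (v t x - v t' x') / (\<bar>t - t'\<bar> powr (\<alpha> / 2) + norm (x - x') powr \<alpha>)))"
  have hn: "holder_norm T \<alpha> v = Linf_norm ({0..T} \<times> UNIV) (\<lambda>(t, x). v t x) + (SUP z\<in>I. Q z)"
    unfolding holder_norm_def I_def Q_def by (simp add: case_prod_unfold)
  have L0: "0 \<le> Linf_norm ({0..T} \<times> UNIV) (\<lambda>(t, x). v t x)"
    unfolding Linf_norm_def using T by (intro SUP_upper2[of "(0, 0)"]) auto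
  have Qle: "Q z \<le> holder_norm T \<alpha> v" if "z \<in> I" for z
  proof -
    have "Q z \<le> 0 + (SUP z\<in>I. Q z)" using that by (simp add: SUP_upper)
    also have "\<dots> \<le> holder_norm T \<alpha> v" unfolding hn using L0 by (intro add_right_mono)
    finally show ?thesis .
  qed
  define H where "H = real_of_ereal (holder_norm T \<alpha> v)"
  have h0: "0 \<le> holder_norm T \<alpha> v"
  proof -
    obtain b :: 'a where "b \<in> Basis" using nonempty_Basis by blast
    then have "(0, 0, T, b) \<in> I" using T by (auto simp: I_def)
    from Qle[OF this] show ?thesis
      unfolding Q_def case_prod_conv by (rule order_trans[rotated]) (simp add: divide_nonneg_nonneg)
  qed
  then have H: "holder_norm T \<alpha> v = ereal H"
    using fin by (cases "holder_norm T \<alpha> v") (auto simp: H_def)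
  have H0: "0 \<le> H" using h0 unfolding H by simp
  then show "0 \<le> real_of_ereal (holder_norm T \<alpha> v)" by (simp add: H_def)
  have adm: "norm (v t x - v t' x') \<le> 2 * H * r powr \<alpha>"
    if "t \<in> {0..T}" "t' \<in> {0..T}" "t \<noteq> t'" "x \<noteq> x'" "\<bar>t - t'\<bar> \<le> r\<^sup>2" "norm (x - x') \<le> r" for t t' x x'
  proof -
    have "norm (v t x - v t' x') / (\<bar>t - t'\<bar> powr (\<alpha> / 2) + norm (x - x') powr \<alpha>) \<le> H"
      using Qle[of "(t, x, t', x')"] that unfolding H by (simp add: I_def Q_def)
    moreover have "0 < \<bar>t - t'\<bar> powr (\<alpha> / 2) + norm (x - x') powr \<alpha>"
      using that by (intro add_pos_pos) auto
    ultimately have "norm (v t x - v t' x') \<le> H * (\<bar>t - t'\<bar> powr (\<alpha> / 2) + norm (x - x') powr \<alpha>)"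
      by (simp add: divide_le_eq)
    also have "\<dots> \<le> H * ((r\<^sup>2) powr (\<alpha> / 2) + r powr \<alpha>)"
      using that H0 \<alpha> by (intro mult_left_mono add_mono powr_mono2) auto
    also have "(r\<^sup>2) powr (\<alpha> / 2) = r powr \<alpha>"
      using r(1) by (simp add: powr_powr flip: powr_numeral)
    finally show ?thesis by simp
  qed
  obtain s where s: "s \<in> {0..T}" "s \<noteq> t" "s \<noteq> t'" "\<bar>t - s\<bar> \<le> r\<^sup>2" "\<bar>s - t'\<bar> \<le> r\<^sup>2"
    using exists_other_time[OF t T _ r(2)] r(1) by auto
  obtain y where y: "y \<noteq> x" "y \<noteq> x'" "norm (x - y) \<le> r" "norm (y - x') \<le> r"
    using exists_other_point[OF r(1,3)] by auto
  have "norm (v t x - v t' x') \<le> norm (v t x - v s y) + norm (v s y - v t' x')"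
    using norm_triangle_ineq[of "v t x - v s y" "v s y - v t' x'"] by simp
  also have "\<dots> \<le> 2 * H * r powr \<alpha> + 2 * H * r powr \<alpha>"
    using s y t by (intro add_mono adm) auto
  finally show "norm (v t x - v t' x') \<le> 4 * real_of_ereal (holder_norm T \<alpha> v) * r powr \<alpha>"
    by (simp add: H_def mult_ac)
qed

context smooth_solution
begin

text \<open>
  The oscillation of \<open>u\<close> that the argument tolerates. The two summands of the denominator make
  the two smallness conditions of \<open>local_gradient_bound\<close> hold.
\<close>
definition osc_threshold :: real where
  "osc_threshold = 1 / (32 * real CARD('n) * Cf * C\<sigma> + 2 * weight * sqrt trace_bound)"

text \<open>
  The solution \<open>r\<close> of \<open>(4 H + 1) r\<^sup>\<alpha> = osc_threshold\<close>; the added \<open>1\<close> covers \<open>H = 0\<close>.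
\<close>
definition radius :: "real \<Rightarrow> real \<Rightarrow> real" where
  "radius \<alpha> H = (osc_threshold / (4 * H + 1)) powr (1 / \<alpha>)"

definition gradient_bound :: "real \<Rightarrow> real \<Rightarrow> real \<Rightarrow> real" where
  "gradient_bound G \<alpha> H = sqrt (exp (weight * osc_threshold\<^sup>2) * (1 + G\<^sup>2 + (2 + 22 * trace_bound) / (radius \<alpha> H)\<^sup>2))"

lemma norm_gradient_le:
  assumes terminal: "\<And>x. norm (Dx u T x) \<le> G" and fin: "holder_norm T \<alpha> u < \<infinity>" and \<alpha>: "0 < \<alpha>"
    and t: "t \<in> {0..T}"
  shows "norm (Dx u t x) \<le> gradient_bound G \<alpha> (real_of_ereal (holder_norm T \<alpha> u))"
proof -
  define H where "H = real_of_ereal (holder_norm T \<alpha> u)"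
  have H0: "0 \<le> H"
    unfolding H_def by (rule holder_norm_imp_oscillation_le(1)[OF T_pos fin \<alpha> t t, of 1 0 0]) auto
  define a b where "a = 32 * real CARD('n) * Cf * C\<sigma>" and "b = 2 * weight * sqrt trace_bound"
  have ab: "0 < a" "0 < b"
    using pos weight_pos trace_bound_pos by (simp_all add: a_def b_def)
  have scale: "osc_threshold = 1 / (a + b)"
    by (simp add: osc_threshold_def a_def b_def)
  then have os: "0 < osc_threshold" using ab by simp
  have "a * osc_threshold \<le> 1" "b * osc_threshold \<le> 1"
    using ab by (simp_all add: scale pos_divide_le_eq)
  then have 1: "32 * real CARD('n) * Cf * osc_threshold * C\<sigma> \<le> 1" and "2 * weight * sqrt trace_bound * osc_threshold \<le> 1"
    by (simp_all add: a_def b_def mult_ac)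
  from this(2) have "(2 * weight * sqrt trace_bound * osc_threshold)\<^sup>2 \<le> 1"
    using os weight_pos trace_bound_pos by (intro power_le_one) auto
  then have 2: "4 * weight\<^sup>2 * osc_threshold\<^sup>2 * trace_bound \<le> 1"
    using trace_bound_pos by (simp add: power_mult_distrib mult_ac)
  have quo: "0 < osc_threshold / (4 * H + 1)" using os H0 by simp
  have r: "0 < radius \<alpha> H" "radius \<alpha> H powr \<alpha> = osc_threshold / (4 * H + 1)"
    using quo \<alpha> os H0 by (simp_all add: radius_def powr_powr)
  have "4 * H * radius \<alpha> H powr \<alpha> \<le> osc_threshold"
    unfolding r(2) using os H0 by (simp add: divide_le_eq algebra_simps)
  moreover have "norm (u s y - u t x) \<le> 4 * H * radius \<alpha> H powr \<alpha>"
    if "s \<in> {t..T}" "s - t \<le> (radius \<alpha> H)\<^sup>2" "norm (y - x) \<le> radius \<alpha> H" for s y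
    unfolding H_def
    by (rule holder_norm_imp_oscillation_le(2)[OF T_pos fin \<alpha>]) (use that t r(1) in \<open>auto simp: H_def\<close>)
  ultimately have "(norm (Dx u t x))\<^sup>2 \<le>
      exp (weight * osc_threshold\<^sup>2) * (1 + G\<^sup>2 + (2 + 22 * trace_bound) / (radius \<alpha> H)\<^sup>2)"
    using terminal by (intro local_gradient_bound[OF t r(1) _ 1 2]) (blast intro: order_trans)+
  then show ?thesis
    unfolding gradient_bound_def H_def[symmetric] by (rule real_le_rsqrt)
qed

end

section \<open>Solutions in coordinate-free form and the gradient bound\<close>

text \<open>
  \<open>C12\<close> gives joint continuity of the derivatives, and continuity of the function itself only in each
  variable. The local bound on the spatial derivative makes the function Lipschitz in space,
  uniformly in time, which yields joint continuity.
\<close>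
lemma C12_imp_continuous_on:
  fixes v :: "real \<Rightarrow> 'a::euclidean_space \<Rightarrow> 'b::real_normed_vector"
  assumes "compact I" "C12 I v"
  shows "continuous_on (I \<times> UNIV) (\<lambda>(t, x). v t x)"
proof -
  obtain vt and vx :: "real \<Rightarrow> 'a \<Rightarrow> 'a \<Rightarrow>\<^sub>L 'b" where
    vt: "\<And>t x. t \<in> I \<Longrightarrow> ((\<lambda>s. v s x) has_vector_derivative vt t x) (at t within I)"
    and vx: "\<And>t x. t \<in> I \<Longrightarrow> (v t has_derivative blinfun_apply (vx t x)) (at x)"
    and vx_cont: "continuous_on (I \<times> UNIV) (\<lambda>(t, x). vx t x)"
    using assms(2) unfolding C12_def by blast
  show ?thesis
    unfolding continuous_on_def
  proof safe
    fix t0 x0 assume t0: "t0 \<in> I"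
    have "compact ((\<lambda>(t, x). vx t x) ` (I \<times> cball x0 1))"
      by (intro compact_continuous_image continuous_on_subset[OF vx_cont] compact_Times assms(1)) auto
    then obtain M where "\<forall>y\<in>(\<lambda>(t, x). vx t x) ` (I \<times> cball x0 1). norm y \<le> M"
      using compact_imp_bounded bounded_iff by blast
    then have M: "norm (vx t x) \<le> M" if "t \<in> I" "x \<in> cball x0 1" for t x
      using that by fastforce
    have lip: "norm (v t x - v t x0) \<le> M * norm (x - x0)" if "t \<in> I" "x \<in> cball x0 1" for t x
    proof (rule differentiable_bound[of "cball x0 1" "v t" "\<lambda>x. blinfun_apply (vx t x)"])
      show "onorm (blinfun_apply (vx t y)) \<le> M" if "y \<in> cball x0 1" for y
        using M[OF \<open>t \<in> I\<close> that] by (simp add: norm_blinfun.rep_eq)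
    qed (use that in \<open>auto intro!: has_derivative_at_withinI vx\<close>)
    let ?F = "at (t0, x0) within I \<times> UNIV"
    have fst: "((\<lambda>z. v (fst z) x0) \<longlongrightarrow> v t0 x0) ?F"
    proof -
      have "continuous_on I (\<lambda>s. v s x0)"
        using vt has_vector_derivative_continuous continuous_on_eq_continuous_within by blast
      then have "continuous_on (I \<times> (UNIV :: 'a set)) (\<lambda>z. v (fst z) x0)"
        by (rule continuous_on_compose2) (auto intro!: continuous_intros)
      then show ?thesis using t0 by (auto simp: continuous_on_def)
    qed
    have "((\<lambda>z. v (fst z) (snd z) - v (fst z) x0) \<longlongrightarrow> 0) ?F"
    proof (rule Lim_null_comparison)
      have lim: "((\<lambda>z. norm (snd z - x0)) \<longlongrightarrow> 0) ?F"
        by (auto intro!: tendsto_eq_intros)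
      then show "((\<lambda>z. M * norm (snd z - x0)) \<longlongrightarrow> 0) ?F"
        by (auto intro!: tendsto_eq_intros)
      have "eventually (\<lambda>z. norm (snd z - x0) < 1) ?F"
        using lim by (rule order_tendstoD) simp
      moreover have "eventually (\<lambda>z. z \<in> I \<times> UNIV) ?F"
        by (simp add: eventually_at_filter)
      ultimately show "eventually (\<lambda>z. norm (v (fst z) (snd z) - v (fst z) x0) \<le> M * norm (snd z - x0)) ?F"
        by eventually_elim (auto intro!: lip simp: dist_norm norm_minus_commute)
    qed
    from tendsto_add[OF this fst] show "((\<lambda>(t, x). v t x) \<longlongrightarrow> v t0 x0) ?F"
      by (simp add: case_prod_unfold)
  qed
qed

lemma trace_diffusion:
  fixes S D :: "real^'d^'d"
  shows "trace (((1 / 2) *\<^sub>R (S ** transpose S)) ** D)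
    = 1 / 2 * (\<Sum>m\<in>UNIV. (D *v (S *v axis m 1)) \<bullet> (S *v axis m 1))"
proof -
  have "trace (((1 / 2) *\<^sub>R (S ** transpose S)) ** D) = 1 / 2 * trace (D ** S ** transpose S)"
    unfolding trace_mul_sym[of _ D] matrix_mul_assoc[symmetric]
    by (simp add: matrix_scalar_ac trace_def sum_distrib_left scalar_matrix_assoc[symmetric] flip: scalar_mult_eq_scaleR)
  also have "trace (D ** S ** transpose S) = (\<Sum>i\<in>UNIV. \<Sum>m\<in>UNIV. (D *v (S *v axis m 1)) $ i * (S *v axis m 1) $ i)"
    by (simp add: trace_def matrix_matrix_mult_def transpose_def matrix_vector_mult_def axis_def
        if_distrib cong: if_cong)
  also have "\<dots> = (\<Sum>m\<in>UNIV. (D *v (S *v axis m 1)) \<bullet> (S *v axis m 1))"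
    by (subst sum.swap) (simp add: inner_vec_def)
  finally show ?thesis .
qed

lemma jacobian_component_mult:
  fixes A :: "real^'d \<Rightarrow> real^'d^'n"
  assumes "(A has_derivative A') (at x)"
  shows "jacobian (\<lambda>y. A y $ i) (at x) *v z = A' z $ i"
proof -
  have d: "((\<lambda>y. A y $ i) has_derivative (\<lambda>z. A' z $ i)) (at x)"
    by (rule bounded_linear.has_derivative[OF bounded_linear_vec_nth assms])
  then have "((\<lambda>y. A y $ i) has_derivative (*v) (jacobian (\<lambda>y. A y $ i) (at x))) (at x)"
    using jacobian_works differentiable_def by blast
  from has_derivative_unique[OF this d] show ?thesis by (rule fun_cong)
qed

lemma smooth_solution_exists:
  fixes \<sigma> :: "real \<Rightarrow> real^'d \<Rightarrow> real^'n::{finite,linorder} \<Rightarrow> real^'d^'d"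
  assumes T: "0 < T"
    and sigma: "sigma_cond T L\<sigma> C\<sigma> \<sigma>" and f: "f_cond T Cf \<epsilon> f"
    and sigma_C1: "\<forall>t\<in>{0..T}. C1 (\<lambda>(x, v). \<sigma> t x v)"
    and f_C1: "\<forall>t\<in>{0..T}. C1 (\<lambda>(x, v, p). f t x v p)"
    and u: "classical_solution T \<sigma> f g u" and Du: "C12 {0..T} (Dx u)"
  obtains ut At B D3 where "smooth_solution T L\<sigma> C\<sigma> Cf \<epsilon> \<sigma> f u ut At B D3"
proof -
  have "C12 {0..<T} u" using u by (simp add: classical_solution_def)
  then obtain ut where ut: "\<And>t x. t \<in> {0..<T} \<Longrightarrow> ((\<lambda>s. u s x) has_vector_derivative ut t x) (at t within {0..<T})"
    unfolding C12_def by blast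
  obtain At B D3 where
    At: "\<And>t x. t \<in> {0..T} \<Longrightarrow> ((\<lambda>s. Dx u s x) has_vector_derivative At t x) (at t within {0..T})"
    and B: "\<And>t x. t \<in> {0..T} \<Longrightarrow> (Dx u t has_derivative blinfun_apply (B t x)) (at x)"
    and D3: "\<And>t x. t \<in> {0..T} \<Longrightarrow> (B t has_derivative blinfun_apply (D3 t x)) (at x)"
    and At_cont: "continuous_on ({0..T} \<times> UNIV) (\<lambda>(t, x). At t x)"
    and D3_cont: "continuous_on ({0..T} \<times> UNIV) (\<lambda>(t, x). D3 t x)"
    using Du unfolding C12_def by blast
  have "smooth_solution T L\<sigma> C\<sigma> Cf \<epsilon> \<sigma> f u ut At B D3"
  proof
    show "0 < T" "sigma_cond T L\<sigma> C\<sigma> \<sigma>" "f_cond T Cf \<epsilon> f" by fact+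
    show "(\<lambda>(x, v). \<sigma> t x v) differentiable at z" if "t \<in> {0..T}" for t z
      using sigma_C1 that unfolding C1_def differentiable_def by blast
    show "(\<lambda>(x, v, p). f t x v p) differentiable at z" if "t \<in> {0..T}" for t z
      using f_C1 that unfolding C1_def differentiable_def by blast
    show "continuous_on ({0..T} \<times> UNIV) (\<lambda>(t, x). u t x)"
      "bounded ((\<lambda>(t, x). u t x) ` ({0..T} \<times> UNIV))"
      "bounded ((\<lambda>(t, x). Dx u t x) ` ({0..T} \<times> UNIV))"
      using u by (simp_all add: classical_solution_def)
    show "continuous_on ({0..T} \<times> UNIV) (\<lambda>(t, x). Dx u t x)"
      by (rule C12_imp_continuous_on[OF _ Du]) simp
    show "(u t has_derivative (*v) (Dx u t x)) (at x)" if "t \<in> {0..T}" for t x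
      using u that unfolding classical_solution_def Dx_def by (simp add: jacobian_works)
    show "((\<lambda>s. u s x) has_vector_derivative ut t x) (at t within {0..<T})" if "t \<in> {0..<T}" for t x
      by (rule ut[OF that])
    show "((\<lambda>s. Dx u s x) has_vector_derivative At t x) (at t within {0..<T})" if "t \<in> {0..<T}" for t x
      using At[of t x] that by (auto intro: has_vector_derivative_within_subset)
    show "(Dx u t has_derivative blinfun_apply (B t x)) (at x)"
      "(B t has_derivative blinfun_apply (D3 t x)) (at x)" if "t \<in> {0..T}" for t x
      using B D3 that by auto
    show "continuous_on ({0..T} \<times> UNIV) (\<lambda>(t, x). At t x)" by fact
    show "continuous_on UNIV (D3 t)" if "t \<in> {0..T}" for t
      using continuous_on_compose2[OF D3_cont, of UNIV "\<lambda>x. (t, x)"] that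
      by (simp add: image_subset_iff continuous_on_Pair continuous_on_const continuous_on_id)
    show "ut t x + (1 / 2) *\<^sub>R (\<Sum>m\<in>UNIV. B t x (\<sigma> t x (u t x) *v axis m 1) *v (\<sigma> t x (u t x) *v axis m 1))
        + f t x (u t x) (Dx u t x) = 0" if t: "t \<in> {0..<T}" for t x
    proof (subst vec_eq_iff, rule allI)
      fix i
      let ?S = "\<sigma> t x (u t x)"
      have t': "t \<in> {0..T}" using t by auto
      have "((\<lambda>s. u s x $ i) has_vector_derivative ut t x $ i) (at t within {0..<T})"
        by (rule bounded_linear.has_vector_derivative[OF bounded_linear_vec_nth ut[OF t]])
      then have "vector_derivative (\<lambda>s. u s x $ i) (at t within {0..<T}) = ut t x $ i"
        by (rule vector_derivative_within[OF at_within_Ico_neq_bot[OF t]])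
      moreover have "vector_derivative (\<lambda>s. u s x $ i) (at t within {0..<T})
          + trace (((1 / 2) *\<^sub>R (?S ** transpose ?S)) ** Dxx u i t x) + f t x (u t x) (Dx u t x) $ i = 0"
        using u t unfolding classical_solution_def by blast
      moreover have "trace (((1 / 2) *\<^sub>R (?S ** transpose ?S)) ** Dxx u i t x)
          = 1 / 2 * (\<Sum>m\<in>UNIV. (B t x (?S *v axis m 1) *v (?S *v axis m 1)) $ i)"
        unfolding trace_diffusion Dxx_def jacobian_component_mult[OF B[OF t']]
        by (simp add: matrix_vector_mul_component)
      ultimately show "(ut t x + (1 / 2) *\<^sub>R (\<Sum>m\<in>UNIV. B t x (?S *v axis m 1) *v (?S *v axis m 1))
        + f t x (u t x) (Dx u t x)) $ i = 0 $ i"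
        by simp
    qed
  qed
  then show ?thesis by (rule that)
qed

theorem theorem2p7:
  fixes T :: real
  assumes "0 < T"
  shows "\<exists>C :: ereal \<Rightarrow> real \<Rightarrow> real \<Rightarrow> real \<Rightarrow> real \<Rightarrow> ereal \<Rightarrow> real.
    \<forall>(\<sigma> :: real \<Rightarrow> real^'d \<Rightarrow> real^'n::{finite,linorder} \<Rightarrow> real^'d^'d)
     (f :: real \<Rightarrow> real^'d \<Rightarrow> real^'n::{finite,linorder} \<Rightarrow> real^'d^'n::{finite,linorder} \<Rightarrow> real^'n::{finite,linorder})
     (g :: real^'d \<Rightarrow> real^'n::{finite,linorder}) (u :: real \<Rightarrow> real^'d \<Rightarrow> real^'n::{finite,linorder})
     L\<sigma> C\<sigma> Cf \<epsilon> \<alpha>.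
      sigma_cond T L\<sigma> C\<sigma> \<sigma> \<longrightarrow>
      f_cond T Cf \<epsilon> f \<longrightarrow>
      (\<forall>t\<in>{0..T}. C1 (\<lambda>(x, v). \<sigma> t x v)) \<longrightarrow>
      (\<forall>t\<in>{0..T}. C1 (\<lambda>(x, v, p). f t x v p)) \<longrightarrow>
      C1 g \<longrightarrow>
      bounded (range (\<lambda>x. jacobian g (at x))) \<longrightarrow>
      classical_solution T \<sigma> f g u \<longrightarrow>
      C12 {0..T} (Dx u) \<longrightarrow>
      0 < \<alpha> \<longrightarrow> \<alpha> < 1 \<longrightarrow>
      Linf_norm ({0..T} \<times> UNIV) (\<lambda>(t, x). Dx u t x)
        \<le> ereal (C (Linf_norm UNIV (\<lambda>x. jacobian g (at x))) C\<sigma> L\<sigma> Cf \<alpha> (holder_norm T \<alpha> u))"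
proof (intro exI allI impI)
  fix \<sigma> :: "real \<Rightarrow> real^'d \<Rightarrow> real^'n::{finite,linorder} \<Rightarrow> real^'d^'d"
    and f :: "real \<Rightarrow> real^'d \<Rightarrow> real^'n::{finite,linorder} \<Rightarrow> real^'d^'n::{finite,linorder} \<Rightarrow> real^'n::{finite,linorder}"
    and g :: "real^'d \<Rightarrow> real^'n::{finite,linorder}" and u :: "real \<Rightarrow> real^'d \<Rightarrow> real^'n::{finite,linorder}"
    and L\<sigma> C\<sigma> Cf \<epsilon> \<alpha> :: real
  assume hyps: "sigma_cond T L\<sigma> C\<sigma> \<sigma>" "f_cond T Cf \<epsilon> f"
    "\<forall>t\<in>{0..T}. C1 (\<lambda>(x, v). \<sigma> t x v)" "\<forall>t\<in>{0..T}. C1 (\<lambda>(x, v, p). f t x v p)"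
    and g: "bounded (range (\<lambda>x. jacobian g (at x)))"
    and u: "classical_solution T \<sigma> f g u" "C12 {0..T} (Dx u)" and \<alpha>: "0 < \<alpha>" "\<alpha> < 1"
  obtain ut At B D3 where "smooth_solution T L\<sigma> C\<sigma> Cf \<epsilon> \<sigma> f u ut At B D3"
    by (rule smooth_solution_exists[OF assms hyps u])
  then interpret smooth_solution T L\<sigma> C\<sigma> Cf \<epsilon> \<sigma> f u ut At B D3 .
  let ?G = "Linf_norm UNIV (\<lambda>x. jacobian g (at x))"
  obtain M where M: "\<And>x. norm (jacobian g (at x)) \<le> M"
    using g unfolding bounded_iff by blast
  have le: "ereal (norm (jacobian g (at x))) \<le> ?G" for x
    unfolding Linf_norm_def by (rule SUP_upper) simp
  have "?G \<le> ereal M"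
    unfolding Linf_norm_def by (rule SUP_least) (simp add: M)
  then obtain G where G: "?G = ereal G"
    using le[of 0] by (cases ?G) auto
  have "u T = g"
    using u(1) unfolding classical_solution_def by blast
  then have terminal: "norm (Dx u T x) \<le> real_of_ereal ?G" for x
    using le[of x] by (simp add: Dx_def G)
  have bound: "norm (Dx u t x) \<le> gradient_bound (real_of_ereal ?G) \<alpha> (real_of_ereal (holder_norm T \<alpha> u))"
    if "t \<in> {0..T}" for t x
    by (rule norm_gradient_le[OF terminal holder_norm_finite[OF \<alpha>] \<alpha>(1) that])
  \<comment> \<open>\<open>gradient_bound\<close> is built from the structural constants and the two dimensions only, so it serves all
      solutions at once.\<close>
  show "Linf_norm ({0..T} \<times> UNIV) (\<lambda>(t, x). Dx u t x)
      \<le> ereal ((\<lambda>G C\<sigma> L\<sigma> Cf \<alpha> H. smooth_solution.gradient_bound TYPE('d) TYPE('n) L\<sigma> C\<sigma> Cf (real_of_ereal G) \<alpha> (real_of_ereal H))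
        ?G C\<sigma> L\<sigma> Cf \<alpha> (holder_norm T \<alpha> u))"
    unfolding Linf_norm_def[of "{0..T} \<times> UNIV"] by (rule SUP_least) (auto intro: bound)
qed

end
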